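(* Let $n\geq 1$. For $0<\sigma<2$ let $I(\sigma)=\omega_n\int_0^\infty(1+\rho^2)^{-(n+\sigma)/2}\rho^{n-1}\,d\rho$, where $\omega_n$ is the surface area of the unit sphere in $\mathbb{R}^n$, and for $y>0$, $x\in\mathbb{R}^n$ set \[P^\sigma_y(x)=(I(\sigma))^{-1}\,y^{\sigma}\,(y^2+|x|^2)^{-(n+\sigma)/2}.\] Let $Mf(x)=\sup_{r>0}|B(x,r)|^{-1}\int_{B(x,r)}|f(z)|\,dz$ be the Hardy--Littlewood maximal operator. \begin{enumerate} \item[(a)] The operator $P^*f(x)=\sup_{y>0,\,0<\sigma<2}|(P^\sigma_y\ast f)(x)|$ satisfies $P^*f(x)\leq C\,Mf(x)$ for a constant $C$ (independent of $f$ and $x$). Hence $P^*$ is of weak type $(1,1)$ and bounded on $L^p(\mathbb{R}^n)$ for $1<p\leq\infty$. \item[(b)] If $\Sigma:\mathbb{R}^+\to(0,2)$ is a function such that $\Sigma(y)\log y\to-\infty$ as $y\to0^+$, then the family $\{P^{\Sigma(y)}_y:y>0\}$ concentrates about the origin, i.e. for every $\lambda>0$, $\int_{|x|>\lambda}P^{\Sigma(y)}_y(x)\,dx\to0$ as $y\to0^+$. \item[(c)] With $\Sigma$ as in (b), for every $f\in L^p(\mathbb{R}^n)$, $1\leq p\leq\infty$, $(P^{\Sigma(y)}_y\ast f)(x)\to f(x)$ as $y\to0^+$ for almost every $x\in\mathbb{R}^n$. \end{enumerate}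
   Context: An operator $T$ is of weak type $(1,1)$ if there is $C>0$ with $|\{x:|Tf(x)|>\lambda\}|\leq C\lambda^{-1}\|f\|_1$ for all $f\in L^1(\mathbb{R}^n)$ and $\lambda>0$; it is bounded on $L^p$ if $\|Tf\|_p\leq C\|f\|_p$. *)

theory Defs
  imports "HOL-Analysis.Analysis"
begin

text \<open>Surface area of the unit sphere in R^n (with the convention omega 1 = 2).\<close>
definition sphere_area :: "nat \<Rightarrow> real" where
  "sphere_area n = 2 * pi powr (real n / 2) / Gamma (real n / 2)"

definition I_const :: "nat \<Rightarrow> real \<Rightarrow> real" where
  "I_const n \<sigma> = sphere_area n *
     (LBINT \<rho>:{0<..}. (1 + \<rho>\<^sup>2) powr (- (real n + \<sigma>) / 2) * \<rho> ^ (n - 1))"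

definition poisson :: "real \<Rightarrow> real \<Rightarrow> 'a::euclidean_space \<Rightarrow> real" where
  "poisson \<sigma> y x = y powr \<sigma> * (y\<^sup>2 + (norm x)\<^sup>2) powr (- (real DIM('a) + \<sigma>) / 2)
                    / I_const DIM('a) \<sigma>"

definition conv :: "('a::euclidean_space \<Rightarrow> real) \<Rightarrow> ('a \<Rightarrow> real) \<Rightarrow> 'a \<Rightarrow> real" where
  "conv k f x = (\<integral> z. k (x - z) * f z \<partial>lebesgue)"

definition maximal :: "('a::euclidean_space \<Rightarrow> real) \<Rightarrow> 'a \<Rightarrow> ennreal" where
  "maximal f x = (SUP r\<in>{0<..}. (\<integral>\<^sup>+ z\<in>ball x r. ennreal \<bar>f z\<bar> \<partial>lebesgue) / emeasure lebesgue (ball x r))"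

definition Pstar :: "('a::euclidean_space \<Rightarrow> real) \<Rightarrow> 'a \<Rightarrow> ennreal" where
  "Pstar f x = (SUP p\<in>{0<..} \<times> {0<..<2}. ennreal \<bar>conv (poisson (snd p) (fst p)) f x\<bar>)"

definition in_Lp :: "real \<Rightarrow> ('a::euclidean_space \<Rightarrow> real) \<Rightarrow> bool" where
  "in_Lp p f \<longleftrightarrow> f \<in> borel_measurable lebesgue \<and> integrable lebesgue (\<lambda>x. \<bar>f x\<bar> powr p)"

definition Lp_norm :: "real \<Rightarrow> ('a::euclidean_space \<Rightarrow> real) \<Rightarrow> real" where
  "Lp_norm p f = (\<integral> x. \<bar>f x\<bar> powr p \<partial>lebesgue) powr (1 / p)"

definition in_Linf :: "('a::euclidean_space \<Rightarrow> real) \<Rightarrow> bool" where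
  "in_Linf f \<longleftrightarrow> f \<in> borel_measurable lebesgue \<and> (\<exists>K. AE x in lebesgue. \<bar>f x\<bar> \<le> K)"

end

theory Submission
  imports Defs
begin

text \<open>
  The distribution of the distance to a fixed point has density
  \<open>\<omega>\<^sub>n r\<^sup>n\<^sup>-\<^sup>1\<close> (volume of balls), which shows that every kernel
  has total mass 1. A radially decreasing kernel is a superposition of indicators of balls, so
  convolution with it is dominated by its mass times the maximal function, uniformly in all
  parameters. Vitali's covering lemma gives the weak type bound and truncation at height
  \<open>t / 2\<close> (Marcinkiewicz) the strong one. Comparing \<open>I(\<sigma>)\<close> from below
  with \<open>\<omega>\<^sub>n 2\<^bsup>-(n+\<sigma>)/2\<^esup> / \<sigma>\<close> bounds the mass outside a ball of radius
  \<open>d\<close> by a constant times \<open>(y / d)\<^sup>\<sigma>\<close>. Almost everywhere convergence then holds for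
  bounded continuous functions, passes to integrable ones by density and the weak type bound, and is
  localised for the remaining ones because far away mass does not contribute.
\<close>

section \<open>Radial integration\<close>

text \<open>The exponent \<sigma> varies, in (b) and (c) together with y, so the kernels are not
  dilates of one fixed function and every estimate must be uniform in \<sigma>. The danger is
  \<sigma> near 0: the tail integral of r^(-1-\<sigma>) has size 1/\<sigma>, and a bound survives
  only because I(\<sigma>) is at least as large up to a constant. What is left, (y/d)^\<sigma>,
  equals exp(\<sigma> ln y) up to a bounded factor, which is where the hypothesis on Sigma(y) log y
  enters. The domination holds with C = 1 because each kernel has mass exactly 1. Measurability
  shapes the statements. Level sets of \<open>maximal\<close> are enclosed in open sets, exceptional
  sets are covered by small measurable ones, and \<open>Pstar\<close>, an uncountable supremum, is
  reached through continuity of the convolutions. Functions in L^p with p > 1, and bounded ones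
  above all, need not be integrable, so density in L^1 reaches them only after cutting them off to
  balls.\<close>

lemma sigma_finite_lebesgue: "sigma_finite_measure (lebesgue :: 'a::euclidean_space measure)"
proof -
  obtain \<A> :: "'a set set" where "countable \<A>" "\<A> \<subseteq> sets lborel" "\<Union>\<A> = space lborel"
      "\<forall>a\<in>\<A>. emeasure lborel a \<noteq> \<infinity>"
    using lborel.sigma_finite_countable by metis
  then show ?thesis
    by (intro sigma_finite_measure.intro exI[of _ \<A>]) auto
qed

interpretation lebesgue: sigma_finite_measure "lebesgue :: 'a::euclidean_space measure"
  by (rule sigma_finite_lebesgue)

text \<open>Each exchange of integrals below pairs a space variable, in which functions are only
  Lebesgue measurable, with a radius or level on the real line, in which they are Borel; hence the
  mixed product.\<close>

interpretation lebesgue_lborel: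
  pair_sigma_finite "lebesgue :: 'a::euclidean_space measure" "lborel :: 'b::euclidean_space measure" ..

lemma emeasure_lebesgue_ball:
  "r \<ge> 0 \<Longrightarrow> emeasure lebesgue (ball (x::'a::euclidean_space) r)
     = ennreal (unit_ball_vol DIM('a) * r ^ DIM('a))"
  by (simp add: emeasure_ball)

text \<open>The functional equation of Gamma turns the closed formula into the derivative of the
  ball volume at radius 1, the form in which radial integration uses it.\<close>

lemma sphere_area_eq:
  assumes "n > 0" shows "sphere_area n = real n * unit_ball_vol n"
proof -
  have "Gamma (real n / 2 + 1) = real n / 2 * Gamma (real n / 2)"
    by (rule Gamma_plus1) (use assms in \<open>auto elim!: nonpos_Ints_cases\<close>)
  moreover have "Gamma (real n / 2) > 0" using assms by (intro Gamma_real_pos) simp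
  ultimately show ?thesis
    using assms unfolding sphere_area_def unit_ball_vol_def by (simp only:) (simp add: field_simps)
qed

lemma sphere_area_pos: "n > 0 \<Longrightarrow> sphere_area n > 0"
  by (simp add: sphere_area_eq)

text \<open>The half-lines \<open>{..<a}\<close> generate the Borel sets and their preimages under
  \<open>dist x\<close> are balls. It is enough to compare the measures there, where the claim says
  that the ball volume is the integral of its derivative in the radius.\<close>

lemma distr_dist_lborel:
  fixes x :: "'a::euclidean_space"
  shows "distr lborel borel (dist x)
    = density lborel (\<lambda>r. ennreal (sphere_area DIM('a) * r ^ (DIM('a) - 1)) * indicator {0..} r)"
    (is "?M = ?N")
proof -
  let ?n = "DIM('a)" and ?E = "range (\<lambda>a::real. {..<a})"
  define dens where "dens = (\<lambda>r::real. sphere_area ?n * r ^ (?n - 1))"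
  have ballM: "emeasure ?M {..<a} = emeasure lborel (ball x a)" for a
  proof -
    have "emeasure ?M {..<a} = emeasure lborel (dist x -` {..<a} \<inter> space lborel)"
      by (rule emeasure_distr) auto
    also have "dist x -` {..<a} \<inter> space lborel = ball x a" by auto
    finally show ?thesis .
  qed
  show ?thesis
  proof (rule measure_eqI_generator_eq[where E = ?E and \<Omega> = UNIV and A = "\<lambda>i. {..<real i}"])
    show "Int_stable ?E"
      unfolding Int_stable_def
    proof safe
      fix a b :: real
      have "{..<a} \<inter> {..<b} = {..<min a b}" by auto
      then show "{..<a} \<inter> {..<b} \<in> ?E" by blast
    qed
    show "sets ?M = sigma_sets UNIV ?E" "sets ?N = sigma_sets UNIV ?E"
      by (simp_all add: borel_Iio)
    show "(\<Union>i. {..<real i}) = UNIV" using reals_Archimedean2 by auto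
    fix X assume "X \<in> ?E"
    then obtain a where X: "X = {..<a}" by auto
    show "emeasure ?M X = emeasure ?N X"
    proof (cases "a > 0")
      case False
      have "emeasure ?N X = (\<integral>\<^sup>+r. ennreal (dens r) * indicator {0..} r * indicator X r \<partial>lborel)"
        unfolding X dens_def by (subst emeasure_density) auto
      also have "\<dots> = (\<integral>\<^sup>+(r::real). 0 \<partial>lborel)"
        by (rule nn_integral_cong) (use False in \<open>auto simp: X split: split_indicator\<close>)
      finally have "emeasure ?N X = 0" by simp
      then show ?thesis using False by (simp add: X ballM ball_empty)
    next
      case True
      have "emeasure ?N X = (\<integral>\<^sup>+r. ennreal (dens r) * indicator {0..} r * indicator X r \<partial>lborel)"
        unfolding X dens_def by (subst emeasure_density) auto
      \<comment> \<open>The endpoint \<open>a\<close> is added, a null set, because the fundamental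
        theorem of calculus is applied on a closed interval.\<close>
      also have "\<dots> = (\<integral>\<^sup>+r. ennreal (dens r) * indicator {0..a} r \<partial>lborel)"
        using AE_lborel_singleton[of a]
        by (intro nn_integral_cong_AE) (auto elim!: eventually_mono simp: X split: split_indicator)
      also have "\<dots> = ennreal (unit_ball_vol ?n * a ^ ?n - unit_ball_vol ?n * 0 ^ ?n)"
      proof (rule nn_integral_FTC_Icc[where F = "\<lambda>r. unit_ball_vol ?n * r ^ ?n"])
        show "dens \<in> borel_measurable borel" unfolding dens_def by measurable
        show "((\<lambda>r. unit_ball_vol ?n * r ^ ?n) has_field_derivative dens r) (at r)" for r
          unfolding dens_def by (auto intro!: derivative_eq_intros simp: sphere_area_eq)
        show "0 \<le> dens r" if "r \<in> {0..a}" for r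
          using that sphere_area_pos[of ?n] by (simp add: dens_def less_imp_le)
      qed (use True in auto)
      also have "\<dots> = emeasure ?M X" using True by (simp add: X ballM emeasure_ball)
      finally show ?thesis by simp
    qed
  qed (auto simp: ballM emeasure_ball)
qed

lemma nn_integral_radial:
  fixes x :: "'a::euclidean_space"
  assumes [measurable]: "F \<in> borel_measurable borel"
  shows "(\<integral>\<^sup>+z. F (dist x z) \<partial>lebesgue)
    = (\<integral>\<^sup>+r. ennreal (sphere_area DIM('a) * r ^ (DIM('a) - 1)) * indicator {0..} r * F r \<partial>lborel)"
proof -
  have "(\<integral>\<^sup>+z. F (dist x z) \<partial>lebesgue) = (\<integral>\<^sup>+r. F r \<partial>distr lborel borel (dist x))"
    by (simp add: nn_integral_completion nn_integral_distr)
  then show ?thesis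
    unfolding distr_dist_lborel by (simp add: nn_integral_density)
qed

section \<open>The normalising constant I(\<sigma>) and its size for small \<sigma>\<close>

lemma nn_integral_powr_tail:
  fixes a \<sigma> :: real
  assumes "a > 0" "\<sigma> > 0"
  shows "(\<integral>\<^sup>+r. ennreal (r powr (-1 - \<sigma>)) * indicator {a..} r \<partial>lborel) = ennreal (a powr (-\<sigma>) / \<sigma>)"
proof -
  have "(\<integral>\<^sup>+r. ennreal (r powr (-1 - \<sigma>)) * indicator {a..} r \<partial>lborel)
      = ennreal (0 - (- (a powr (-\<sigma>) / \<sigma>)))"
  proof (rule nn_integral_FTC_atLeast)
    show "((\<lambda>r. - (r powr (-\<sigma>) / \<sigma>)) has_field_derivative r powr (-1 - \<sigma>)) (at r)" if "a \<le> r" for r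
      using that assms by (auto intro!: derivative_eq_intros simp: powr_diff powr_minus field_simps)
    have "((\<lambda>r. - (r powr (-\<sigma>) / \<sigma>)) \<longlongrightarrow> - (0 / \<sigma>)) at_top"
      using assms by (intro tendsto_intros tendsto_neg_powr filterlim_ident) auto
    then show "((\<lambda>r. - (r powr (-\<sigma>) / \<sigma>)) \<longlongrightarrow> 0) at_top" by simp
  qed auto
  then show ?thesis by simp
qed

lemma square_powr: "r > 0 \<Longrightarrow> (r\<^sup>2) powr (a / 2) = r powr (a::real)"
  by (simp add: powr_powr flip: powr_numeral)

text \<open>Dropping \<open>y\<^sup>2\<close> leaves a pure power of r. With y = 1 this gives
  finiteness of I(\<sigma>), with general y the tail of the kernel.\<close>

lemma profile_decay:
  fixes r y s :: real
  assumes "r > 0" "s > 0" "n > 0"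
  shows "(y\<^sup>2 + r\<^sup>2) powr (- (real n + s) / 2) * r ^ (n - 1) \<le> r powr (-1 - s)"
proof -
  have "(y\<^sup>2 + r\<^sup>2) powr (- (real n + s) / 2) \<le> (r\<^sup>2) powr (- (real n + s) / 2)"
    using assms by (intro powr_mono2') auto
  also have "\<dots> = r powr (- (real n + s))"
    using assms by (intro square_powr)
  finally have "(y\<^sup>2 + r\<^sup>2) powr (- (real n + s) / 2) * r ^ (n - 1) \<le> r powr (- (real n + s)) * r ^ (n - 1)"
    using assms by (intro mult_right_mono) auto
  also have "r powr (- (real n + s)) * r ^ (n - 1) = r powr (- (real n + s)) * r powr (real n - 1)"
    using assms by (simp add: powr_realpow[symmetric] of_nat_diff)
  also have "\<dots> = r powr (-1 - s)"
    by (simp add: powr_add[symmetric] algebra_simps)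
  finally show ?thesis .
qed

text \<open>For r >= 1 one has 1 + r^2 <= 2 r^2, which bounds the integrand below by a multiple of
  r^(-1-\<sigma>); this is where the essential 1/\<sigma> comes from. For finiteness the integrand
  is at most 1 on [0,1] and at most r^(-1-\<sigma>) beyond.\<close>

lemma I_integral_bounds:
  fixes \<sigma> :: real
  assumes "n > 0" "\<sigma> > 0"
  defines "J \<equiv> (\<integral>\<^sup>+r. ennreal ((1 + r\<^sup>2) powr (- (real n + \<sigma>) / 2) * r ^ (n - 1)) * indicator {0..} r \<partial>lborel)"
  shows "ennreal (2 powr (- (real n + \<sigma>) / 2) / \<sigma>) \<le> J" "J < top"
proof -
  let ?h = "\<lambda>r::real. (1 + r\<^sup>2) powr (- (real n + \<sigma>) / 2) * r ^ (n - 1)"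
  let ?c = "2 powr (- (real n + \<sigma>) / 2)"
  have "ennreal (?c / \<sigma>) = ennreal ?c * ennreal (1 powr (-\<sigma>) / \<sigma>)"
    using assms by (simp add: ennreal_mult[symmetric])
  also have "\<dots> = (\<integral>\<^sup>+r. ennreal ?c * (ennreal (r powr (-1 - \<sigma>)) * indicator {1..} r) \<partial>lborel)"
    using assms by (subst nn_integral_cmult) (auto simp: nn_integral_powr_tail)
  also have "\<dots> \<le> J"
    unfolding J_def
  proof (intro nn_integral_mono)
    fix r :: real
    show "ennreal ?c * (ennreal (r powr (-1 - \<sigma>)) * indicator {1..} r) \<le> ennreal (?h r) * indicator {0..} r"
    proof (cases "r \<ge> 1")
      case True
      have "?c * r powr (-1 - \<sigma>) = ?c * r powr (- (real n + \<sigma>)) * r powr (real n - 1)"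
        by (simp add: powr_add[symmetric] algebra_simps)
      also have "r powr (real n - 1) = r ^ (n - 1)"
        using assms True by (simp add: powr_realpow[symmetric] of_nat_diff)
      also have "?c * r powr (- (real n + \<sigma>)) = (2 * r\<^sup>2) powr (- (real n + \<sigma>) / 2)"
        using True by (subst powr_mult) (simp_all only: square_powr)
      also have "\<dots> \<le> (1 + r\<^sup>2) powr (- (real n + \<sigma>) / 2)"
        using True assms by (intro powr_mono2') (auto simp: one_le_power add_pos_nonneg)
      finally have "?c * r powr (-1 - \<sigma>) \<le> ?h r"
        using True by (simp add: mult_right_mono)
      then show ?thesis using True by (simp add: ennreal_mult[symmetric] ennreal_leI)
    qed auto
  qed
  finally show "ennreal (?c / \<sigma>) \<le> J" .
  have "J \<le> (\<integral>\<^sup>+r. indicator {0..1} r + ennreal (r powr (-1 - \<sigma>)) * indicator {1..} r \<partial>lborel)"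
    unfolding J_def
  proof (intro nn_integral_mono)
    fix r :: real
    consider "r < 0" | "0 \<le> r" "r \<le> 1" | "r > 1" by linarith
    then show "ennreal (?h r) * indicator {0..} r
        \<le> indicator {0..1} r + ennreal (r powr (-1 - \<sigma>)) * indicator {1..} r"
    proof cases
      case 2
      have "(1 + r\<^sup>2) powr (- (real n + \<sigma>) / 2) \<le> 1 powr (- (real n + \<sigma>) / 2)"
        using assms by (intro powr_mono2') auto
      then have "?h r \<le> 1 * 1"
        using 2 by (intro mult_mono power_le_one) auto
      then have "ennreal (?h r) \<le> ennreal 1" by (intro ennreal_leI) simp
      then have "ennreal (?h r) * indicator {0..} r \<le> indicator {0..1} r"
        using 2 by simp
      then show ?thesis by (rule order_trans) simp
    next
      case 3
      have "ennreal (?h r) \<le> ennreal (r powr (-1 - \<sigma>))"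
        using profile_decay[of r \<sigma> n 1] 3 assms(1,2) by (intro ennreal_leI) simp
      then show ?thesis using 3 by simp
    qed auto
  qed
  also have "\<dots> = 1 + ennreal (1 powr (-\<sigma>) / \<sigma>)"
    using assms by (subst nn_integral_add) (auto simp: nn_integral_powr_tail)
  also have "\<dots> < top" by simp
  finally show "J < top" .
qed

text \<open>\<open>I_const\<close> is a Bochner integral, which would be 0 if the integrand were not
  integrable. The finite upper bound excludes this, and afterwards all computations can be done with
  nonnegative integrals.\<close>

lemma I_const_eq_nn_integral:
  fixes \<sigma> :: real
  assumes "n > 0" "\<sigma> > 0"
  shows "ennreal (I_const n \<sigma>) = ennreal (sphere_area n) *
    (\<integral>\<^sup>+r. ennreal ((1 + r\<^sup>2) powr (- (real n + \<sigma>) / 2) * r ^ (n - 1)) * indicator {0..} r \<partial>lborel)"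
proof -
  let ?h = "\<lambda>r::real. (1 + r\<^sup>2) powr (- (real n + \<sigma>) / 2) * r ^ (n - 1)"
  have eq: "(\<integral>\<^sup>+r. ennreal (?h r) * indicator {0..} r \<partial>lborel) = (\<integral>\<^sup>+r. ennreal (indicator {0<..} r * ?h r) \<partial>lborel)"
    using AE_lborel_singleton[of 0]
    by (intro nn_integral_cong_AE) (auto elim!: eventually_mono split: split_indicator)
  have "ennreal (LBINT r:{0<..}. ?h r) = (\<integral>\<^sup>+r. ennreal (indicator {0<..} r * ?h r) \<partial>lborel)"
    unfolding set_lebesgue_integral_def real_scaleR_def
  proof (rule nn_integral_eq_integral[symmetric])
    show "integrable lborel (\<lambda>r. indicator {0<..} r * ?h r)"
    proof (rule integrableI_nonneg)
      show "(\<integral>\<^sup>+r. ennreal (indicator {0<..} r * ?h r) \<partial>lborel) < \<infinity>"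
        using I_integral_bounds(2)[OF assms] unfolding eq by (simp add: infinity_ennreal_def)
    qed (auto simp: indicator_def intro!: AE_I2)
  qed (auto simp: indicator_def intro!: AE_I2)
  then show ?thesis
    unfolding I_const_def eq using sphere_area_pos[OF assms(1)]
    by (subst ennreal_mult') auto
qed

lemma I_const_lower:
  fixes \<sigma> :: real
  assumes "n > 0" "\<sigma> > 0"
  shows "sphere_area n * (2 powr (- (real n + \<sigma>) / 2) / \<sigma>) \<le> I_const n \<sigma>"
proof -
  have pos: "0 < sphere_area n * (2 powr (- (real n + \<sigma>) / 2) / \<sigma>)"
    using assms by (simp add: sphere_area_pos)
  have "ennreal (sphere_area n * (2 powr (- (real n + \<sigma>) / 2) / \<sigma>)) \<le> ennreal (I_const n \<sigma>)"
    unfolding I_const_eq_nn_integral[OF assms]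
    using I_integral_bounds(1)[OF assms] sphere_area_pos[OF assms(1)] assms
    by (subst ennreal_mult) (auto intro!: mult_left_mono)
  \<comment> \<open>\<open>ennreal\<close> truncates negative numbers to 0, so the inequality
    descends to the reals only because its left side is positive.\<close>
  then show ?thesis
    using pos by (metis ennreal_le_iff2 not_le)
qed

lemma I_const_pos:
  fixes \<sigma> :: real
  assumes "n > 0" "\<sigma> > 0" shows "I_const n \<sigma> > 0"
proof -
  have "0 < sphere_area n * (2 powr (- (real n + \<sigma>) / 2) / \<sigma>)"
    using assms by (simp add: sphere_area_pos)
  then show ?thesis using I_const_lower[OF assms] by linarith
qed


section \<open>The Poisson kernels\<close>

definition poisson_profile :: "nat \<Rightarrow> real \<Rightarrow> real \<Rightarrow> real \<Rightarrow> real" where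
  "poisson_profile n \<sigma> y r = y powr \<sigma> * (y\<^sup>2 + r\<^sup>2) powr (- (real n + \<sigma>) / 2) / I_const n \<sigma>"

lemma poisson_eq_profile:
  "poisson \<sigma> y (x - z) = poisson_profile DIM('a) \<sigma> y (dist x (z::'a::euclidean_space))"
  by (simp add: poisson_def poisson_profile_def dist_norm)

lemma poisson_measurable [measurable]: "poisson \<sigma> y \<in> borel_measurable borel"
  unfolding poisson_def by measurable

lemma poisson_profile_measurable [measurable]: "poisson_profile n \<sigma> y \<in> borel_measurable borel"
  unfolding poisson_profile_def by measurable

lemma poisson_nonneg: "\<sigma> > 0 \<Longrightarrow> poisson \<sigma> y (x::'a::euclidean_space) \<ge> 0"
  using I_const_pos[of "DIM('a)" \<sigma>] unfolding poisson_def by (auto intro!: divide_nonneg_pos)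

text \<open>In polar coordinates the substitution r -> y r produces y from the measure, y^(n-1) from
  the density, y^\<sigma> from the prefactor and y^(-n-\<sigma>) from the power. Their product is 1,
  and the integral defining I(\<sigma>) remains.\<close>

lemma nn_integral_poisson:
  fixes x :: "'a::euclidean_space"
  assumes y: "y > 0" and s: "\<sigma> > 0"
  shows "(\<integral>\<^sup>+z. ennreal (poisson \<sigma> y (x - z)) \<partial>lebesgue) = 1"
proof -
  let ?n = "DIM('a)" and ?w = "sphere_area DIM('a)" and ?I = "I_const DIM('a) \<sigma>"
  let ?h = "\<lambda>r::real. (1 + r\<^sup>2) powr (- (real ?n + \<sigma>) / 2) * r ^ (?n - 1)"
  have Ipos: "?I > 0" and wpos: "?w > 0" using s by (auto simp: I_const_pos sphere_area_pos)
  define G where "G = (\<lambda>r. ennreal (?w * r ^ (?n - 1)) * indicator {0..} r * ennreal (poisson_profile ?n \<sigma> y r))"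
  have "(\<integral>\<^sup>+z. ennreal (poisson \<sigma> y (x - z)) \<partial>lebesgue) = (\<integral>\<^sup>+r. G r \<partial>lborel)"
    unfolding poisson_eq_profile G_def by (subst nn_integral_radial) auto
  also have "\<dots> = ennreal \<bar>y\<bar> * (\<integral>\<^sup>+r. G (0 + y * r) \<partial>lborel)"
    by (rule nn_integral_real_affine) (use y in \<open>auto simp: G_def\<close>)
  also have "\<dots> = (\<integral>\<^sup>+r. ennreal \<bar>y\<bar> * G (0 + y * r) \<partial>lborel)"
    by (rule nn_integral_cmult[symmetric]) (auto simp: G_def)
  also have "\<dots> = (\<integral>\<^sup>+r. ennreal (?w / ?I) * (ennreal (?h r) * indicator {0..} r) \<partial>lborel)"
  proof (rule nn_integral_cong)
    fix r :: real
    show "ennreal \<bar>y\<bar> * G (0 + y * r) = ennreal (?w / ?I) * (ennreal (?h r) * indicator {0..} r)"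
    proof (cases "r \<ge> 0")
      case False
      then have "y * r < 0" using y by (simp add: mult_pos_neg)
      then show ?thesis using False by (simp add: G_def)
    next
      case True
      have "(y\<^sup>2 + (y * r)\<^sup>2) powr (- (real ?n + \<sigma>) / 2) = (y\<^sup>2 * (1 + r\<^sup>2)) powr (- (real ?n + \<sigma>) / 2)"
        by (simp add: algebra_simps power_mult_distrib)
      also have "\<dots> = y powr (- (real ?n + \<sigma>)) * (1 + r\<^sup>2) powr (- (real ?n + \<sigma>) / 2)"
        using y by (subst powr_mult) (simp_all only: square_powr)
      finally have *: "(y\<^sup>2 + (y * r)\<^sup>2) powr (- (real ?n + \<sigma>) / 2)
          = y powr (- (real ?n + \<sigma>)) * (1 + r\<^sup>2) powr (- (real ?n + \<sigma>) / 2)" .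
      have "y * y ^ (?n - 1) = y powr (real ?n)"
        using y by (simp add: powr_realpow power_eq_if)
      then have **: "y * y ^ (?n - 1) * y powr \<sigma> * y powr (- (real ?n + \<sigma>)) = 1"
        using y by (simp add: powr_add[symmetric])
      have "y * (?w * (y * r) ^ (?n - 1)) * poisson_profile ?n \<sigma> y (y * r)
          = (y * y ^ (?n - 1) * y powr \<sigma> * y powr (- (real ?n + \<sigma>))) * (?w / ?I * ?h r)"
        unfolding poisson_profile_def * by (simp add: power_mult_distrib del: minus_add_distrib)
      also have "\<dots> = ?w / ?I * ?h r" unfolding ** by simp
      finally have "y * (?w * (y * r) ^ (?n - 1)) * poisson_profile ?n \<sigma> y (y * r) = ?w / ?I * ?h r" .
      moreover have "poisson_profile ?n \<sigma> y (y * r) \<ge> 0"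
        unfolding poisson_profile_def using Ipos y by (intro divide_nonneg_pos) auto
      ultimately show ?thesis using True y wpos Ipos
        by (simp add: G_def ennreal_mult[symmetric] mult.assoc)
    qed
  qed
  also have "\<dots> = ennreal (1 / ?I) * (ennreal ?w * (\<integral>\<^sup>+r. ennreal (?h r) * indicator {0..} r \<partial>lborel))"
    using wpos Ipos
    by (subst nn_integral_cmult) (auto simp: ennreal_mult[symmetric] mult.assoc[symmetric])
  also have "\<dots> = ennreal (1 / ?I) * ennreal ?I"
    using s by (subst I_const_eq_nn_integral) auto
  also have "\<dots> = 1" using Ipos by (simp add: ennreal_mult[symmetric])
  finally show ?thesis .
qed

text \<open>The tail of r^(-1-\<sigma>) contributes d^(-\<sigma>)/\<sigma>. The factor 1/\<sigma> is
  absorbed by the lower bound for I(\<sigma>), so the constant depends on the dimension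
  alone.\<close>

lemma nn_integral_poisson_tail:
  fixes x :: "'a::euclidean_space"
  assumes y: "y > 0" and s: "0 < \<sigma>" "\<sigma> < 2" and d: "d > 0"
  shows "(\<integral>\<^sup>+z. ennreal (poisson \<sigma> y (x - z)) * indicator {z. d \<le> dist x z} z \<partial>lebesgue)
     \<le> ennreal (2 powr (real DIM('a) / 2 + 1) * (y / d) powr \<sigma>)"
proof -
  let ?n = "DIM('a)" and ?w = "sphere_area DIM('a)" and ?I = "I_const DIM('a) \<sigma>"
  have Ipos: "?I > 0" and wpos: "?w > 0" using s by (auto simp: I_const_pos sphere_area_pos)
  have "(\<integral>\<^sup>+z. ennreal (poisson \<sigma> y (x - z)) * indicator {z. d \<le> dist x z} z \<partial>lebesgue)
      = (\<integral>\<^sup>+z. (\<lambda>r. ennreal (poisson_profile ?n \<sigma> y r) * indicator {d..} r) (dist x z) \<partial>lebesgue)"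
    unfolding poisson_eq_profile by (intro nn_integral_cong) (auto simp: indicator_def)
  also have "\<dots> = (\<integral>\<^sup>+r. ennreal (?w * r ^ (?n - 1)) * indicator {0..} r *
      (ennreal (poisson_profile ?n \<sigma> y r) * indicator {d..} r) \<partial>lborel)"
    by (rule nn_integral_radial) measurable
  also have "\<dots> \<le> (\<integral>\<^sup>+r. ennreal (?w * y powr \<sigma> / ?I) * (ennreal (r powr (-1 - \<sigma>)) * indicator {d..} r) \<partial>lborel)"
  proof (rule nn_integral_mono)
    fix r :: real
    show "ennreal (?w * r ^ (?n - 1)) * indicator {0..} r *
      (ennreal (poisson_profile ?n \<sigma> y r) * indicator {d..} r)
      \<le> ennreal (?w * y powr \<sigma> / ?I) * (ennreal (r powr (-1 - \<sigma>)) * indicator {d..} r)"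
    proof (cases "d \<le> r")
      case True
      then have r: "r > 0" using d by linarith
      have "?w * r ^ (?n - 1) * poisson_profile ?n \<sigma> y r
          = ?w * y powr \<sigma> / ?I * ((y\<^sup>2 + r\<^sup>2) powr (- (real ?n + \<sigma>) / 2) * r ^ (?n - 1))"
        by (simp add: poisson_profile_def)
      also have "\<dots> \<le> ?w * y powr \<sigma> / ?I * r powr (-1 - \<sigma>)"
        using r s Ipos wpos by (intro mult_left_mono profile_decay) auto
      finally have "ennreal (?w * r ^ (?n - 1) * poisson_profile ?n \<sigma> y r)
          \<le> ennreal (?w * y powr \<sigma> / ?I * r powr (-1 - \<sigma>))"
        by (rule ennreal_leI)
      also have "\<dots> = ennreal (?w * y powr \<sigma> / ?I) * ennreal (r powr (-1 - \<sigma>))"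
        using wpos Ipos by (intro ennreal_mult) auto
      also have "ennreal (?w * r ^ (?n - 1) * poisson_profile ?n \<sigma> y r)
          = ennreal (?w * r ^ (?n - 1)) * ennreal (poisson_profile ?n \<sigma> y r)"
        using wpos r by (intro ennreal_mult') auto
      finally show ?thesis using True r by simp
    qed auto
  qed
  also have "\<dots> = ennreal (?w * y powr \<sigma> / ?I) * ennreal (d powr (-\<sigma>) / \<sigma>)"
    using d s by (subst nn_integral_cmult) (auto simp: nn_integral_powr_tail)
  also have "\<dots> = ennreal (?w * y powr \<sigma> / ?I * (d powr (-\<sigma>) / \<sigma>))"
    using wpos Ipos s by (simp add: ennreal_mult[symmetric])
  also have "\<dots> \<le> ennreal (2 powr (real ?n / 2 + 1) * (y / d) powr \<sigma>)"
  proof (rule ennreal_leI)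
    have "?w / \<sigma> * 2 powr (- (real ?n + \<sigma>) / 2) \<le> ?I"
      using I_const_lower[of ?n \<sigma>] s by simp
    then have "?w / \<sigma> * 2 powr (- (real ?n + \<sigma>) / 2) * 2 powr ((real ?n + \<sigma>) / 2) \<le> ?I * 2 powr ((real ?n + \<sigma>) / 2)"
      by (rule mult_right_mono) simp
    moreover have "2 powr (- (real ?n + \<sigma>) / 2) * 2 powr ((real ?n + \<sigma>) / 2) = (1::real)"
      unfolding powr_add[symmetric] by (simp del: minus_add_distrib)
    ultimately have "?w / \<sigma> \<le> ?I * 2 powr ((real ?n + \<sigma>) / 2)"
      by (simp only: mult.assoc mult_1_right)
    \<comment> \<open>Here \<sigma> < 2 enters: (n + \<sigma>)/2 is at most n/2 + 1, which removes
      \<sigma> from the constant.\<close>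
    also have "\<dots> \<le> ?I * 2 powr (real ?n / 2 + 1)"
      using Ipos s by (intro mult_left_mono powr_mono) auto
    finally have "?w / \<sigma> / ?I \<le> 2 powr (real ?n / 2 + 1)"
      using Ipos by (simp only: pos_divide_le_eq mult.commute)
    then have "?w / \<sigma> / ?I * (y / d) powr \<sigma> \<le> 2 powr (real ?n / 2 + 1) * (y / d) powr \<sigma>"
      by (rule mult_right_mono) simp
    moreover have "?w * y powr \<sigma> / ?I * (d powr (-\<sigma>) / \<sigma>) = ?w / \<sigma> / ?I * (y / d) powr \<sigma>"
      using y d by (simp add: powr_divide powr_minus field_simps)
    ultimately show "?w * y powr \<sigma> / ?I * (d powr (-\<sigma>) / \<sigma>) \<le> 2 powr (real ?n / 2 + 1) * (y / d) powr \<sigma>"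
      by simp
  qed
  finally show ?thesis .
qed

section \<open>The maximal function\<close>

text \<open>The density \<open>\<kappa>\<close> is minus the derivative of the profile; it writes the kernel as a
  superposition of indicators of balls.\<close>

lemma poisson_profile_layers:
  fixes y \<sigma> :: real
  assumes n: "n > 0" and y: "y > 0" and s: "\<sigma> > 0"
  obtains \<kappa> :: "real \<Rightarrow> ennreal" where "\<kappa> \<in> borel_measurable borel"
    "\<And>\<rho>. \<rho> \<ge> 0 \<Longrightarrow> ennreal (poisson_profile n \<sigma> y \<rho>) = (\<integral>\<^sup>+r. \<kappa> r * indicator {\<rho><..} r \<partial>lborel)"
proof
  let ?e = "- (real n + \<sigma>) / 2"
  define c where "c = y powr \<sigma> / I_const n \<sigma>"
  have c: "c \<ge> 0" using I_const_pos[OF n s] by (simp add: c_def)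
  define d where "d = (\<lambda>r::real. c * ((real n + \<sigma>) * r * (y\<^sup>2 + r\<^sup>2) powr (?e - 1)))"
  have [measurable]: "d \<in> borel_measurable borel" unfolding d_def by measurable
  show "(\<lambda>r. ennreal (d r)) \<in> borel_measurable borel" by measurable
  fix \<rho> :: real assume \<rho>: "\<rho> \<ge> 0"
  have pos: "y\<^sup>2 + r\<^sup>2 > 0" for r :: real using y by (simp add: add_pos_nonneg)
  have "(\<integral>\<^sup>+r. ennreal (d r) * indicator {\<rho>..} r \<partial>lborel) = ennreal (0 - (- poisson_profile n \<sigma> y \<rho>))"
  proof (rule nn_integral_FTC_atLeast)
    fix r assume "\<rho> \<le> r"
    then show "0 \<le> d r" using c \<rho> s by (simp add: d_def)
    show "((\<lambda>r. - poisson_profile n \<sigma> y r) has_field_derivative d r) (at r)"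
    proof -
      have "((\<lambda>r. - (c * (y\<^sup>2 + r\<^sup>2) powr ?e)) has_field_derivative
          - (c * (?e * (y\<^sup>2 + r\<^sup>2) powr (?e - 1) * (2 * r)))) (at r)"
        using pos[of r] by (auto intro!: derivative_eq_intros simp: powr_diff)
      moreover have "- (c * (?e * (y\<^sup>2 + r\<^sup>2) powr (?e - 1) * (2 * r))) = d r"
        unfolding d_def by (simp add: field_simps)
      ultimately show ?thesis
        unfolding poisson_profile_def c_def by simp
    qed
  next
    have "filterlim (\<lambda>r::real. y\<^sup>2 + r\<^sup>2) at_top at_top"
      by (intro filterlim_tendsto_add_at_top[OF tendsto_const] filterlim_pow_at_top filterlim_ident) auto
    then have "((\<lambda>r. (y\<^sup>2 + r\<^sup>2) powr ?e) \<longlongrightarrow> 0) at_top"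
      using s by (intro tendsto_neg_powr) auto
    then have "((\<lambda>r. - (c * (y\<^sup>2 + r\<^sup>2) powr ?e)) \<longlongrightarrow> - (c * 0)) at_top"
      by (intro tendsto_intros)
    then show "((\<lambda>r. - poisson_profile n \<sigma> y r) \<longlongrightarrow> 0) at_top"
      by (simp add: poisson_profile_def c_def)
  qed simp
  \<comment> \<open>The closed ray suits the fundamental theorem. The open ray is the one wanted:
    \<open>dist x z < r\<close> then describes the open balls over which \<open>maximal\<close>
    averages.\<close>
  moreover have "(\<integral>\<^sup>+r. ennreal (d r) * indicator {\<rho>..} r \<partial>lborel) = (\<integral>\<^sup>+r. ennreal (d r) * indicator {\<rho><..} r \<partial>lborel)"
    using AE_lborel_singleton[of \<rho>]
    by (intro nn_integral_cong_AE) (auto elim!: eventually_mono split: split_indicator)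
  ultimately show "ennreal (poisson_profile n \<sigma> y \<rho>) = (\<integral>\<^sup>+r. ennreal (d r) * indicator {\<rho><..} r \<partial>lborel)"
    by simp
qed

lemma emeasure_lebesgue_ball_pos_finite:
  assumes "r > 0"
  shows "emeasure lebesgue (ball (x::'a::euclidean_space) r) \<noteq> 0"
    "emeasure lebesgue (ball x r) \<noteq> top"
proof -
  have "0 < unit_ball_vol DIM('a) * r ^ DIM('a)" using assms by simp
  then show "emeasure lebesgue (ball x r) \<noteq> 0" "emeasure lebesgue (ball x r) \<noteq> top"
    using assms by (simp_all only: emeasure_lebesgue_ball less_imp_le ennreal_eq_0_iff not_le) auto
qed

lemma nn_integral_ball_le_maximal:
  fixes x :: "'a::euclidean_space"
  shows "(\<integral>\<^sup>+z\<in>ball x r. ennreal \<bar>f z\<bar> \<partial>lebesgue) \<le> maximal f x * emeasure lebesgue (ball x r)"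
proof (cases "r > 0")
  case True
  let ?A = "\<integral>\<^sup>+z\<in>ball x r. ennreal \<bar>f z\<bar> \<partial>lebesgue" and ?m = "emeasure lebesgue (ball x r)"
  have m: "?m \<noteq> 0" "?m \<noteq> top" using True by (rule emeasure_lebesgue_ball_pos_finite)+
  have "?A = ?A / ?m * ?m"
    using m by (simp add: ennreal_divide_times ennreal_divide_self less_top)
  also have "\<dots> \<le> maximal f x * ?m"
    unfolding maximal_def using True by (intro mult_right_mono SUP_upper2[of r]) auto
  finally show ?thesis .
qed (simp add: ball_empty)

text \<open>By Tonelli, integrating g against the kernel amounts to integrating over r, with weight
  \<open>\<kappa> r\<close>, the integrals of g over the balls of radius r. For g = |f| each of
  these is at most \<open>maximal f x\<close> times the volume of the ball.\<close>

lemma radial_conv_le_maximal: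
  fixes x :: "'a::euclidean_space" and \<kappa> :: "real \<Rightarrow> ennreal"
  assumes \<kappa>[measurable]: "\<kappa> \<in> borel_measurable borel" and f[measurable]: "f \<in> borel_measurable lebesgue"
  defines "k \<equiv> \<lambda>\<rho>. \<integral>\<^sup>+r. \<kappa> r * indicator {\<rho><..} r \<partial>lborel"
  shows "(\<integral>\<^sup>+z. k (dist x z) * ennreal \<bar>f z\<bar> \<partial>lebesgue) \<le> (\<integral>\<^sup>+z. k (dist x z) \<partial>lebesgue) * maximal f x"
proof -
  have [measurable]: "dist x \<in> borel_measurable lebesgue"
    by (rule measurable_completion) measurable
  have swap: "(\<integral>\<^sup>+z. k (dist x z) * g z \<partial>lebesgue) = (\<integral>\<^sup>+r. \<kappa> r * (\<integral>\<^sup>+z\<in>ball x r. g z \<partial>lebesgue) \<partial>lborel)"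
    if [measurable]: "g \<in> borel_measurable lebesgue" for g :: "'a \<Rightarrow> ennreal"
  proof -
    have "(\<integral>\<^sup>+z. k (dist x z) * g z \<partial>lebesgue)
        = (\<integral>\<^sup>+z. (\<integral>\<^sup>+r. \<kappa> r * indicator {dist x z<..} r * g z \<partial>lborel) \<partial>lebesgue)"
      unfolding k_def by (intro nn_integral_cong nn_integral_multc[symmetric]) measurable
    also have "\<dots> = (\<integral>\<^sup>+r. (\<integral>\<^sup>+z. \<kappa> r * indicator {dist x z<..} r * g z \<partial>lebesgue) \<partial>lborel)"
      by (intro lebesgue_lborel.Fubini'[symmetric]) (simp add: greaterThan_def)
    also have "\<dots> = (\<integral>\<^sup>+r. \<kappa> r * (\<integral>\<^sup>+z\<in>ball x r. g z \<partial>lebesgue) \<partial>lborel)"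
      by (subst nn_integral_cmult[symmetric]) (auto intro!: nn_integral_cong simp: indicator_def)
    finally show ?thesis .
  qed
  have meas: "(\<lambda>r. \<kappa> r * emeasure lebesgue (ball x r)) \<in> borel_measurable lborel"
  proof -
    \<comment> \<open>Balls of negative radius are empty, hence \<open>max 0 r\<close>; the explicit
      formula makes the volume visibly measurable in r.\<close>
    have "emeasure lebesgue (ball x r) = ennreal (unit_ball_vol DIM('a) * (max 0 r) ^ DIM('a))" for r
      by (auto simp: max_def emeasure_ball ball_empty)
    then have "(\<lambda>r. \<kappa> r * emeasure lebesgue (ball x r))
        = (\<lambda>r. \<kappa> r * ennreal (unit_ball_vol DIM('a) * (max 0 r) ^ DIM('a)))"
      by presburger
    then show ?thesis by (rule ssubst) measurable
  qed
  have "(\<integral>\<^sup>+z. k (dist x z) * ennreal \<bar>f z\<bar> \<partial>lebesgue)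
      = (\<integral>\<^sup>+r. \<kappa> r * (\<integral>\<^sup>+z\<in>ball x r. ennreal \<bar>f z\<bar> \<partial>lebesgue) \<partial>lborel)"
    by (rule swap) measurable
  also have "\<dots> \<le> (\<integral>\<^sup>+r. \<kappa> r * emeasure lebesgue (ball x r) * maximal f x \<partial>lborel)"
  proof (rule nn_integral_mono)
    fix r
    show "\<kappa> r * (\<integral>\<^sup>+z\<in>ball x r. ennreal \<bar>f z\<bar> \<partial>lebesgue) \<le> \<kappa> r * emeasure lebesgue (ball x r) * maximal f x"
      using mult_left_mono[OF nn_integral_ball_le_maximal[where x=x and f=f and r=r], of "\<kappa> r"]
      by (simp add: mult_ac)
  qed
  also have "\<dots> = (\<integral>\<^sup>+r. \<kappa> r * emeasure lebesgue (ball x r) \<partial>lborel) * maximal f x"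
    using meas by (rule nn_integral_multc)
  \<comment> \<open>The same exchange, read backwards with g = 1, recognises the remaining factor as
    the mass of the kernel.\<close>
  also have "(\<integral>\<^sup>+r. \<kappa> r * emeasure lebesgue (ball x r) \<partial>lborel) = (\<integral>\<^sup>+z. k (dist x z) \<partial>lebesgue)"
    using swap[of "\<lambda>_. 1"] by simp
  finally show ?thesis .
qed

lemma nn_integral_poisson_le_maximal:
  fixes x :: "'a::euclidean_space"
  assumes y: "y > 0" and s: "\<sigma> > 0" and f: "f \<in> borel_measurable lebesgue"
  shows "(\<integral>\<^sup>+z. ennreal (poisson \<sigma> y (x - z)) * ennreal \<bar>f z\<bar> \<partial>lebesgue) \<le> maximal f x"
proof -
  obtain \<kappa> where \<kappa>: "\<kappa> \<in> borel_measurable borel"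
    "\<And>\<rho>. \<rho> \<ge> 0 \<Longrightarrow> ennreal (poisson_profile DIM('a) \<sigma> y \<rho>) = (\<integral>\<^sup>+r. \<kappa> r * indicator {\<rho><..} r \<partial>lborel)"
    using poisson_profile_layers[OF DIM_positive y s] by metis
  show ?thesis
    using radial_conv_le_maximal[OF \<kappa>(1) f, of x] nn_integral_poisson[OF y s, of x]
    by (simp add: poisson_eq_profile \<kappa>(2))
qed

text \<open>If the product is not integrable, \<open>conv\<close> takes the default value 0 and the
  bound is trivial. This is why the maximal function dominates for every measurable f, without any
  integrability.\<close>

lemma ennreal_abs_conv_le:
  assumes s: "\<sigma> > 0"
  shows "ennreal \<bar>conv (poisson \<sigma> y) f x\<bar> \<le> (\<integral>\<^sup>+z. ennreal (poisson \<sigma> y (x - z)) * ennreal \<bar>f z\<bar> \<partial>lebesgue)"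
proof (cases "integrable lebesgue (\<lambda>z. poisson \<sigma> y (x - z) * f z)")
  case True
  have "ennreal \<bar>conv (poisson \<sigma> y) f x\<bar> \<le> (\<integral>\<^sup>+z. norm (poisson \<sigma> y (x - z) * f z) \<partial>lebesgue)"
    unfolding conv_def real_norm_def[symmetric] using True by (rule integral_norm_bound_ennreal)
  also have "\<dots> = (\<integral>\<^sup>+z. ennreal (poisson \<sigma> y (x - z)) * ennreal \<bar>f z\<bar> \<partial>lebesgue)"
    using s by (intro nn_integral_cong) (simp add: abs_mult poisson_nonneg ennreal_mult')
  finally show ?thesis .
qed (simp add: conv_def not_integrable_integral_eq)

lemma Pstar_le_maximal:
  assumes "f \<in> borel_measurable lebesgue"
  shows "Pstar f x \<le> maximal f x"
  unfolding Pstar_def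
  by (intro SUP_least order_trans[OF ennreal_abs_conv_le nn_integral_poisson_le_maximal]) (use assms in auto)

section \<open>The weak type bound by Vitali covering\<close>

text \<open>Each point of the level set is the centre of a ball of volume at most 1/t times the
  integral of |f| over it. Vitali selects disjoint ones whose fivefold enlargements still cover;
  enlarging costs the factor 5^n, and disjointness lets the integrals add up. The open superset
  carries the estimate, so no measurability of the level set enters.\<close>

lemma maximal_weak_type:
  fixes f :: "'a::euclidean_space \<Rightarrow> real" and t :: real
  assumes f[measurable]: "f \<in> borel_measurable lebesgue" and t: "t > 0"
  obtains U where "open U" "{x. ennreal t < maximal f x} \<subseteq> U"
    "emeasure lebesgue U \<le> ennreal (5 ^ DIM('a) / t) * (\<integral>\<^sup>+z. ennreal \<bar>f z\<bar> \<partial>lebesgue)"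
proof (cases "(\<integral>\<^sup>+z. ennreal \<bar>f z\<bar> \<partial>lebesgue) = top")
  case True
  show ?thesis by (rule that[of UNIV]) (use t True in \<open>auto simp: ennreal_mult_top\<close>)
next
  case False
  let ?n = "DIM('a)"
  \<comment> \<open>Taking the integral of |f| over a set as a measure makes the summation over
    disjoint balls an instance of countable additivity.\<close>
  define \<nu> where "\<nu> = density lebesgue (\<lambda>z. ennreal \<bar>f z\<bar>)"
  have sets_\<nu>: "sets \<nu> = sets lebesgue" by (simp add: \<nu>_def)
  have \<nu>_eq: "emeasure \<nu> A = (\<integral>\<^sup>+z\<in>A. ennreal \<bar>f z\<bar> \<partial>lebesgue)" if "A \<in> sets lebesgue" for A
    unfolding \<nu>_def using that by (intro emeasure_density) auto
  define T where "T = enn2real (emeasure \<nu> UNIV)"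
  have T: "emeasure \<nu> UNIV = ennreal T" "T \<ge> 0"
    using False by (auto simp: T_def \<nu>_eq less_top)
  define K where "K = {x. ennreal t < maximal f x}"
  have "\<exists>r>0. ennreal t * emeasure lebesgue (ball x r) \<le> emeasure \<nu> (ball x r)" if "x \<in> K" for x
  proof -
    obtain r where r: "r > 0"
      "ennreal t < (\<integral>\<^sup>+ z\<in>ball x r. ennreal \<bar>f z\<bar> \<partial>lebesgue) / emeasure lebesgue (ball x r)"
      using \<open>x \<in> K\<close> by (auto simp: K_def maximal_def less_SUP_iff)
    let ?m = "emeasure lebesgue (ball x r)"
    have m: "?m \<noteq> 0" "?m \<noteq> top" using r(1) by (rule emeasure_lebesgue_ball_pos_finite)+
    have "ennreal t * ?m \<le> (\<integral>\<^sup>+ z\<in>ball x r. ennreal \<bar>f z\<bar> \<partial>lebesgue) / ?m * ?m"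
      using r by (intro mult_right_mono) auto
    also have "\<dots> = emeasure \<nu> (ball x r)"
      using m by (simp add: ennreal_divide_times ennreal_divide_self less_top \<nu>_eq)
    finally show ?thesis using r by auto
  qed
  then obtain r where r: "\<And>x. x \<in> K \<Longrightarrow> r x > 0"
      "\<And>x. x \<in> K \<Longrightarrow> ennreal t * emeasure lebesgue (ball x (r x)) \<le> emeasure \<nu> (ball x (r x))"
    by metis
  \<comment> \<open>Vitali requires bounded radii. A selected ball satisfies t |ball| <= T, and if
    its radius exceeds 1, the radius is at most its own n-th power, which T controls.\<close>
  define B where "B = max 1 (T / (t * unit_ball_vol ?n))"
  have rB: "0 < r x \<and> r x \<le> B" if "x \<in> K" for x
  proof (cases "r x \<le> 1")
    case True then show ?thesis using r that by (auto simp: B_def)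
  next
    case False
    have "ennreal (t * (unit_ball_vol ?n * r x ^ ?n)) = ennreal t * emeasure lebesgue (ball x (r x))"
      using r(1)[OF that] t by (simp add: emeasure_ball ennreal_mult)
    also have "\<dots> \<le> emeasure \<nu> UNIV"
      using r(2)[OF that] by (rule order_trans) (auto intro!: emeasure_mono simp: sets_\<nu>)
    finally have "t * (unit_ball_vol ?n * r x ^ ?n) \<le> T"
      using T by simp
    then have "r x ^ ?n \<le> T / (t * unit_ball_vol ?n)"
      using t by (simp add: pos_le_divide_eq mult_ac)
    moreover have "r x \<le> r x ^ ?n" using False by (intro self_le_power) auto
    ultimately show ?thesis using False by (auto simp: B_def)
  qed
  obtain C where C: "countable C" "C \<subseteq> K"
     "pairwise (\<lambda>i j. disjnt (ball i (r i)) (ball j (r j))) C"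
     "(\<Union>x\<in>K. ball x (r x)) \<subseteq> (\<Union>i\<in>C. ball i (5 * r i))"
    using Vitali_covering_lemma_balls[where S = "\<Union>x\<in>K. ball x (r x)" and K = K and a = "\<lambda>x. x" and r = r and B = B]
      rB by blast
  \<comment> \<open>The selected family may be finite, so it is indexed by the naturals and padded
    with empty sets. The dilation q is 1 for the disjoint balls and 5 for the covering ones.\<close>
  define E where "E = (\<lambda>q i. if i \<in> to_nat_on C ` C
    then ball (from_nat_into C i) (q * r (from_nat_into C i)) else {})"
  have from_in: "from_nat_into C i \<in> C" if "i \<in> to_nat_on C ` C" for i
    using that C(1) by auto
  have E_UN: "(\<Union>i. E q i) = (\<Union>i\<in>C. ball i (q * r i))" for q
    unfolding E_def using C(1) by (auto split: if_splits)
  have E_sets: "E q i \<in> sets lebesgue" for q i by (simp add: E_def)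
  have disj: "disjoint_family (E 1)"
    unfolding disjoint_family_on_def
  proof safe
    fix i j x assume ij: "i \<noteq> j" and x: "x \<in> E 1 i" "x \<in> E 1 j"
    then have i: "i \<in> to_nat_on C ` C" and j: "j \<in> to_nat_on C ` C"
      by (auto simp: E_def split: if_splits)
    then have "from_nat_into C i \<noteq> from_nat_into C j"
      using ij C(1) by auto
    then have "disjnt (ball (from_nat_into C i) (r (from_nat_into C i))) (ball (from_nat_into C j) (r (from_nat_into C j)))"
      using C(3) from_in i j by (simp add: pairwise_def)
    then show "x \<in> {}" using x i j by (auto simp: E_def disjnt_def)
  qed
  have E5: "emeasure lebesgue (E 5 i) \<le> ennreal (5 ^ ?n / t) * emeasure \<nu> (E 1 i)" for i
  proof (cases "i \<in> to_nat_on C ` C")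
    case True
    define z where "z = from_nat_into C i"
    have z: "z \<in> K" using from_in[OF True] C(2) by (auto simp: z_def)
    have "emeasure lebesgue (E 5 i) = ennreal (5 ^ ?n / t) * (ennreal t * emeasure lebesgue (ball z (r z)))"
      using True r(1)[OF z] t
      by (simp add: E_def z_def[symmetric] emeasure_ball ennreal_mult[symmetric] power_mult_distrib mult_ac)
    also have "\<dots> \<le> ennreal (5 ^ ?n / t) * emeasure \<nu> (ball z (r z))"
      using r(2)[OF z] by (intro mult_left_mono) auto
    finally show ?thesis using True by (simp add: E_def z_def)
  qed (simp add: E_def)
  show ?thesis
  proof (rule that)
    show "open (\<Union>i. E 5 i)" unfolding E_UN by auto
    have "K \<subseteq> (\<Union>x\<in>K. ball x (r x))" using r(1) by force
    then show "{x. ennreal t < maximal f x} \<subseteq> (\<Union>i. E 5 i)"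
      unfolding E_UN using C(4) by (simp add: K_def)
    have "emeasure lebesgue (\<Union>i. E 5 i) \<le> (\<Sum>i. emeasure lebesgue (E 5 i))"
      using E_sets by (intro emeasure_subadditive_countably) auto
    also have "\<dots> \<le> (\<Sum>i. ennreal (5 ^ ?n / t) * emeasure \<nu> (E 1 i))"
      by (intro suminf_le E5) auto
    also have "\<dots> = ennreal (5 ^ ?n / t) * emeasure \<nu> (\<Union>i. E 1 i)"
      using disj E_sets by (simp add: suminf_emeasure sets_\<nu> image_subset_iff)
    also have "\<dots> \<le> ennreal (5 ^ ?n / t) * emeasure \<nu> UNIV"
      by (intro mult_left_mono emeasure_mono) (auto simp: sets_\<nu>)
    finally show "emeasure lebesgue (\<Union>i. E 5 i) \<le> ennreal (5 ^ ?n / t) * (\<integral>\<^sup>+z. ennreal \<bar>f z\<bar> \<partial>lebesgue)"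
      by (simp add: \<nu>_eq)
  qed
qed

section \<open>Measurability and boundedness of the maximal operator of the kernels\<close>

text \<open>A common home for all the spaces \<open>L\<^sup>p\<close>, \<open>1 \<le> p \<le> \<infinity>\<close>: the sum \<open>L\<^sup>1 + L\<^sup>\<infinity>\<close>.\<close>

definition in_Lsum :: "('a::euclidean_space \<Rightarrow> real) \<Rightarrow> bool" where
  "in_Lsum f \<longleftrightarrow> f \<in> borel_measurable lebesgue \<and>
     (\<exists>K g. integrable lebesgue g \<and> (AE z in lebesgue. \<bar>f z\<bar> \<le> K + g z))"

lemma in_LsumI:
  "f \<in> borel_measurable lebesgue \<Longrightarrow> integrable lebesgue g \<Longrightarrow>
    (AE z in lebesgue. \<bar>f z\<bar> \<le> K + g z) \<Longrightarrow> in_Lsum f"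
  unfolding in_Lsum_def by blast

lemma in_Lsum_measurable: "in_Lsum f \<Longrightarrow> f \<in> borel_measurable lebesgue"
  by (simp add: in_Lsum_def)

lemma in_Lsum_bounded:
  "f \<in> borel_measurable lebesgue \<Longrightarrow> (AE z in lebesgue. \<bar>f z\<bar> \<le> K) \<Longrightarrow> in_Lsum f"
  by (rule in_LsumI[where K = K and g = "\<lambda>_. 0"]) auto

lemma in_Lsum_integrable: "integrable lebesgue f \<Longrightarrow> in_Lsum f"
  by (rule in_LsumI[where K = 0 and g = "\<lambda>z. \<bar>f z\<bar>"]) auto

text \<open>Where |f| exceeds 1 it is dominated by |f|^p, so the constant 1 and the integrable
  function |f|^p serve as witnesses.\<close>

lemma in_Lsum_Lp:
  assumes "in_Lp p f" "p \<ge> 1" shows "in_Lsum f"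
proof (rule in_LsumI[where K = 1 and g = "\<lambda>z. \<bar>f z\<bar> powr p"])
  have "\<bar>t\<bar> \<le> 1 + \<bar>t\<bar> powr p" for t :: real
  proof (cases "\<bar>t\<bar> \<le> 1")
    case False
    then have "\<bar>t\<bar> powr 1 \<le> \<bar>t\<bar> powr p" using assms by (intro powr_mono) auto
    then show ?thesis by simp
  qed (simp add: add_increasing2)
  then show "AE z in lebesgue. \<bar>f z\<bar> \<le> 1 + \<bar>f z\<bar> powr p" by simp
qed (use assms in \<open>auto simp: in_Lp_def\<close>)

lemma in_Lsum_mult_indicator:
  assumes "in_Lsum f" "A \<in> sets lebesgue" shows "in_Lsum (\<lambda>z. f z * indicator A z)"
proof -
  have [measurable]: "f \<in> borel_measurable lebesgue" using assms(1) by (rule in_Lsum_measurable)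
  obtain K g where g: "integrable lebesgue g" "AE z in lebesgue. \<bar>f z\<bar> \<le> K + g z"
    using assms(1) by (auto simp: in_Lsum_def)
  show ?thesis
  proof (rule in_LsumI[OF _ g(1), where K = K])
    show "(\<lambda>z. f z * indicator A z) \<in> borel_measurable lebesgue" using assms(2) by measurable
    show "AE z in lebesgue. \<bar>f z * indicator A z\<bar> \<le> K + g z"
      using g(2) by eventually_elim (auto simp: indicator_def)
  qed
qed

lemma poisson_shift_measurable [measurable]:
  "(\<lambda>z. poisson \<sigma> y (x - z)) \<in> borel_measurable (lebesgue :: 'a::euclidean_space measure)"
  by (rule measurable_completion) measurable

lemma integrable_poisson:
  fixes x :: "'a::euclidean_space"
  assumes "y > 0" "\<sigma> > 0"
  shows "integrable lebesgue (\<lambda>z. poisson \<sigma> y (x - z))" "(\<integral>z. poisson \<sigma> y (x - z) \<partial>lebesgue) = 1"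
proof -
  show int: "integrable lebesgue (\<lambda>z. poisson \<sigma> y (x - z))"
    by (rule integrableI_nonneg) (use assms in \<open>auto simp: nn_integral_poisson poisson_nonneg\<close>)
  have "ennreal (\<integral>z. poisson \<sigma> y (x - z) \<partial>lebesgue) = ennreal 1"
    using nn_integral_eq_integral[OF int] assms by (simp add: nn_integral_poisson poisson_nonneg)
  then show "(\<integral>z. poisson \<sigma> y (x - z) \<partial>lebesgue) = 1"
    by (subst (asm) ennreal_inj) (use assms in \<open>auto simp: poisson_nonneg intro!: integral_nonneg\<close>)
qed

lemma poisson_antimono:
  fixes v w :: "'a::euclidean_space"
  assumes "y > 0" "\<sigma> > 0" "norm v \<le> norm w"
  shows "poisson \<sigma> y w \<le> poisson \<sigma> y v"
proof -
  have "(y\<^sup>2 + (norm w)\<^sup>2) powr (- (real DIM('a) + \<sigma>) / 2) \<le> (y\<^sup>2 + (norm v)\<^sup>2) powr (- (real DIM('a) + \<sigma>) / 2)"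
    using assms by (intro powr_mono2') (auto simp: add_pos_nonneg intro!: power_mono)
  then show ?thesis
    using assms I_const_pos[of "DIM('a)" \<sigma>] unfolding poisson_def
    by (intro divide_right_mono mult_left_mono) auto
qed

text \<open>The kernel is both integrable, which handles the constant K, and bounded by its value at
  the origin, which handles the integrable part g.\<close>

lemma integrable_poisson_mult:
  fixes x :: "'a::euclidean_space"
  assumes "y > 0" "\<sigma> > 0" "in_Lsum f"
  shows "integrable lebesgue (\<lambda>z. poisson \<sigma> y (x - z) * f z)"
proof -
  have [measurable]: "f \<in> borel_measurable lebesgue" using assms(3) by (rule in_Lsum_measurable)
  obtain K g where g: "integrable lebesgue g" "AE z in lebesgue. \<bar>f z\<bar> \<le> K + g z"
    using assms(3) by (auto simp: in_Lsum_def)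
  have "integrable lebesgue (\<lambda>z. \<bar>K\<bar> * poisson \<sigma> y (x - z) + poisson \<sigma> y (0::'a) * \<bar>g z\<bar>)"
    using assms g by (intro Bochner_Integration.integrable_add integrable_mult_right integrable_poisson integrable_abs)
  then show ?thesis
  proof (rule Bochner_Integration.integrable_bound)
    show "AE z in lebesgue. norm (poisson \<sigma> y (x - z) * f z)
        \<le> norm (\<bar>K\<bar> * poisson \<sigma> y (x - z) + poisson \<sigma> y (0::'a) * \<bar>g z\<bar>)"
      using g(2)
    proof eventually_elim
      case (elim z)
      have nn: "0 \<le> poisson \<sigma> y (x - z)" using assms by (simp add: poisson_nonneg)
      have "\<bar>f z\<bar> \<le> \<bar>K\<bar> + \<bar>g z\<bar>" using elim by linarith
      then have "poisson \<sigma> y (x - z) * \<bar>f z\<bar> \<le> poisson \<sigma> y (x - z) * (\<bar>K\<bar> + \<bar>g z\<bar>)"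
        using nn by (rule mult_left_mono)
      moreover have "poisson \<sigma> y (x - z) * \<bar>g z\<bar> \<le> poisson \<sigma> y (0::'a) * \<bar>g z\<bar>"
        using assms by (intro mult_right_mono poisson_antimono) auto
      ultimately show ?case using nn by (simp add: abs_mult algebra_simps)
    qed
  qed measurable
qed

section \<open>Continuity of the convolutions\<close>

text \<open>From |w| <= |v| + 1 follows |w|^2 <= 2 |v|^2 + 2, hence y^2 + |w|^2 <= (2 + 2/y^2) (y^2
  + |v|^2). Shifting the centre by at most 1 thus costs a factor independent of the point, and this
  supplies the majorant for dominated convergence.\<close>

lemma poisson_harnack:
  fixes v w :: "'a::euclidean_space"
  assumes "y > 0" "\<sigma> > 0" "dist v w \<le> 1"
  shows "poisson \<sigma> y v \<le> (2 + 2 / y\<^sup>2) powr ((real DIM('a) + \<sigma>) / 2) * poisson \<sigma> y w"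
proof -
  let ?e = "(real DIM('a) + \<sigma>) / 2" and ?c = "2 + 2 / y\<^sup>2"
  have c: "?c > 0" using assms by (simp add: add_pos_nonneg)
  have "norm w \<le> norm v + 1" using assms(3) by (smt (verit) dist_norm norm_triangle_sub norm_minus_commute)
  then have "(norm w)\<^sup>2 \<le> (norm v + 1)\<^sup>2" by (intro power_mono) auto
  also have "\<dots> \<le> 2 * (norm v)\<^sup>2 + 2"
    using sum_squares_bound[of "norm v" 1] by (simp add: power2_sum)
  finally have "y\<^sup>2 + (norm w)\<^sup>2 \<le> y\<^sup>2 + (2 * (norm v)\<^sup>2 + 2)" by simp
  also have "\<dots> \<le> ?c * (y\<^sup>2 + (norm v)\<^sup>2)"
    using assms(1) by (simp add: field_simps)
  finally have le: "y\<^sup>2 + (norm w)\<^sup>2 \<le> ?c * (y\<^sup>2 + (norm v)\<^sup>2)" .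
  have pos: "y\<^sup>2 + (norm v)\<^sup>2 > 0" "y\<^sup>2 + (norm w)\<^sup>2 > 0" using assms(1) by (auto simp: add_pos_nonneg)
  have "(?c * (y\<^sup>2 + (norm v)\<^sup>2)) powr (-?e) \<le> (y\<^sup>2 + (norm w)\<^sup>2) powr (-?e)"
    using le pos assms by (intro powr_mono2') auto
  then have "?c powr ?e * (?c powr (-?e) * (y\<^sup>2 + (norm v)\<^sup>2) powr (-?e)) \<le> ?c powr ?e * (y\<^sup>2 + (norm w)\<^sup>2) powr (-?e)"
    using c pos by (intro mult_left_mono) (auto simp: powr_mult)
  moreover have "?c powr ?e * ?c powr (-?e) = 1"
    using c unfolding powr_add[symmetric] by simp
  ultimately have "(y\<^sup>2 + (norm v)\<^sup>2) powr (-?e) \<le> ?c powr ?e * (y\<^sup>2 + (norm w)\<^sup>2) powr (-?e)"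
    by (simp only: mult.assoc[symmetric] mult_1_left)
  then have "y powr \<sigma> / I_const DIM('a) \<sigma> * (y\<^sup>2 + (norm v)\<^sup>2) powr (-?e)
      \<le> y powr \<sigma> / I_const DIM('a) \<sigma> * (?c powr ?e * (y\<^sup>2 + (norm w)\<^sup>2) powr (-?e))"
    using assms I_const_pos[of "DIM('a)" \<sigma>] by (intro mult_left_mono) auto
  moreover have "- (real DIM('a) + \<sigma>) / 2 = - ?e" by (rule minus_divide_left[symmetric])
  ultimately show ?thesis unfolding poisson_def by (simp only: times_divide_eq_left times_divide_eq_right mult_ac)
qed

text \<open>Once the sequence is within distance 1 of its limit \<open>a\<close>, all integrands are
  dominated by a multiple of the one at \<open>a\<close>; the index is shifted by N for this
  reason.\<close>

lemma continuous_conv_poisson: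
  fixes f :: "'a::euclidean_space \<Rightarrow> real"
  assumes y: "y > 0" and s: "\<sigma> > 0" and f: "in_Lsum f"
  shows "continuous_on UNIV (conv (poisson \<sigma> y) f)"
proof (rule continuous_on_sequentiallyI)
  fix u :: "nat \<Rightarrow> 'a" and a assume u: "u \<longlonglongrightarrow> a"
  have [measurable]: "f \<in> borel_measurable lebesgue" using f by (rule in_Lsum_measurable)
  obtain N where N: "dist (u n) a \<le> 1" if "n \<ge> N" for n
    using metric_LIMSEQ_D[OF u, of 1] by (auto intro: less_imp_le)
  let ?c = "(2 + 2 / y\<^sup>2) powr ((real DIM('a) + \<sigma>) / 2)"
  have pos: "y\<^sup>2 + (norm v)\<^sup>2 > 0" for v :: 'a using y by (auto simp: add_pos_nonneg)
  have cont: "continuous_on UNIV (poisson \<sigma> y :: 'a \<Rightarrow> real)"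
    unfolding poisson_def
    using I_const_pos[of "DIM('a)" \<sigma>] s by (intro continuous_intros ballI pos[THEN less_imp_neq, symmetric]) auto
  have "(\<lambda>n. \<integral>z. poisson \<sigma> y (u (n + N) - z) * f z \<partial>lebesgue) \<longlonglongrightarrow> (\<integral>z. poisson \<sigma> y (a - z) * f z \<partial>lebesgue)"
  proof (rule integral_dominated_convergence)
    show "integrable lebesgue (\<lambda>z. ?c * \<bar>poisson \<sigma> y (a - z) * f z\<bar>)"
      using integrable_poisson_mult[OF y s f, of a] by (intro integrable_mult_right integrable_abs)
    show "AE z in lebesgue. (\<lambda>n. poisson \<sigma> y (u (n + N) - z) * f z) \<longlonglongrightarrow> poisson \<sigma> y (a - z) * f z"
    proof (intro AE_I2 tendsto_intros)
      fix z
      show "(\<lambda>n. poisson \<sigma> y (u (n + N) - z)) \<longlonglongrightarrow> poisson \<sigma> y (a - z)"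
        by (rule continuous_on_tendsto_compose[OF cont]) (auto intro!: tendsto_intros LIMSEQ_ignore_initial_segment u)
    qed
    show "AE z in lebesgue. norm (poisson \<sigma> y (u (n + N) - z) * f z) \<le> ?c * \<bar>poisson \<sigma> y (a - z) * f z\<bar>" for n
    proof (intro AE_I2)
      fix z
      have "dist (u (n + N) - z) (a - z) \<le> 1" using N[of "n + N"] by (simp add: dist_norm)
      then have "poisson \<sigma> y (u (n + N) - z) * \<bar>f z\<bar> \<le> ?c * poisson \<sigma> y (a - z) * \<bar>f z\<bar>"
        by (intro mult_right_mono poisson_harnack y s) auto
      then show "norm (poisson \<sigma> y (u (n + N) - z) * f z) \<le> ?c * \<bar>poisson \<sigma> y (a - z) * f z\<bar>"
        using s by (simp add: abs_mult poisson_nonneg mult_ac)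
    qed
  qed measurable
  then show "(\<lambda>n. conv (poisson \<sigma> y) f (u n)) \<longlonglongrightarrow> conv (poisson \<sigma> y) f a"
    unfolding conv_def by (rule LIMSEQ_offset)
qed

text \<open>A supremum of uncountably many functions, but lower semicontinuous as all of them are continuous.\<close>

lemma Pstar_measurable:
  assumes "in_Lsum f" shows "Pstar f \<in> borel_measurable lebesgue"
proof (rule borel_measurableI_greater)
  fix a :: ennreal
  let ?P = "\<lambda>p x. ennreal \<bar>conv (poisson (snd p) (fst p)) f x\<bar>"
  have "open {x. a < ?P p x}" if "p \<in> {0<..} \<times> {0<..<2}" for p
  proof -
    have "continuous_on UNIV (?P p)"
      using that assms by (intro continuous_intros continuous_on_ennreal continuous_conv_poisson) auto
    then show ?thesis by (intro open_Collect_less) (auto intro: continuous_intros)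
  qed
  then have "open (\<Union>p\<in>{0<..} \<times> {0<..<2}. {x. a < ?P p x})" by blast
  moreover have "{x \<in> space lebesgue. a < Pstar f x} = (\<Union>p\<in>{0<..} \<times> {0<..<2}. {x. a < ?P p x})"
    unfolding Pstar_def less_SUP_iff by fastforce
  ultimately show "{x \<in> space lebesgue. a < Pstar f x} \<in> sets lebesgue"
    by simp
qed

lemma Pstar_weak_type:
  fixes f :: "'a::euclidean_space \<Rightarrow> real"
  assumes f: "f \<in> borel_measurable lebesgue" and t: "t > 0"
  shows "emeasure lebesgue {x. ennreal t < Pstar f x}
    \<le> ennreal (5 ^ DIM('a) / t) * (\<integral>\<^sup>+z. ennreal \<bar>f z\<bar> \<partial>lebesgue)"
proof -
  obtain U where U: "open U" "{x. ennreal t < maximal f x} \<subseteq> U"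
    "emeasure lebesgue U \<le> ennreal (5 ^ DIM('a) / t) * (\<integral>\<^sup>+z. ennreal \<bar>f z\<bar> \<partial>lebesgue)"
    using maximal_weak_type[OF f t] by blast
  have "{x. ennreal t < Pstar f x} \<subseteq> U"
    using U(2) Pstar_le_maximal[OF f] by (auto intro: less_le_trans)
  then have "emeasure lebesgue {x. ennreal t < Pstar f x} \<le> emeasure lebesgue U"
    using U(1) by (intro emeasure_mono) auto
  also note U(3)
  finally show ?thesis .
qed

section \<open>Strong type bounds by truncation and integration over levels\<close>

text \<open>The average of the constant c over any ball is c. This is the form of sublinearity that
  the truncation of f requires.\<close>

lemma maximal_le_add:
  fixes x :: "'a::euclidean_space"
  assumes [measurable]: "f \<in> borel_measurable lebesgue" "h \<in> borel_measurable lebesgue"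
    and c: "c \<ge> 0" and le: "\<And>z. \<bar>f z\<bar> \<le> \<bar>h z\<bar> + c"
  shows "maximal f x \<le> maximal h x + ennreal c"
  unfolding maximal_def[of f]
proof (rule SUP_least)
  fix r :: real assume "r \<in> {0<..}"
  then have r: "r > 0" by simp
  let ?m = "emeasure lebesgue (ball x r)"
  have [measurable]: "ball x r \<in> sets lebesgue" by simp
  have m: "?m \<noteq> 0" "?m < top" using emeasure_lebesgue_ball_pos_finite[OF r, of x] by (simp_all only: less_top simp_thms)
  have "(\<integral>\<^sup>+z\<in>ball x r. ennreal \<bar>f z\<bar> \<partial>lebesgue)
      \<le> (\<integral>\<^sup>+z. ennreal \<bar>h z\<bar> * indicator (ball x r) z + ennreal c * indicator (ball x r) z \<partial>lebesgue)"
    using le c by (intro nn_integral_mono) (auto simp: indicator_def ennreal_plus[symmetric] simp del: ennreal_plus intro!: ennreal_leI)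
  also have "\<dots> = (\<integral>\<^sup>+z\<in>ball x r. ennreal \<bar>h z\<bar> \<partial>lebesgue) + ennreal c * ?m"
    by (subst nn_integral_add) (simp_all add: nn_integral_cmult)
  finally have "(\<integral>\<^sup>+z\<in>ball x r. ennreal \<bar>f z\<bar> \<partial>lebesgue) / ?m
      \<le> ((\<integral>\<^sup>+z\<in>ball x r. ennreal \<bar>h z\<bar> \<partial>lebesgue) + ennreal c * ?m) / ?m"
    by (rule divide_right_mono_ennreal)
  also have "\<dots> = (\<integral>\<^sup>+z\<in>ball x r. ennreal \<bar>h z\<bar> \<partial>lebesgue) / ?m + ennreal c"
    using m by (simp add: add_divide_distrib_ennreal ennreal_times_divide[symmetric] ennreal_divide_self del: emeasure_completion)
  also have "\<dots> \<le> maximal h x + ennreal c"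
    unfolding maximal_def using r by (intro add_right_mono SUP_upper) auto
  finally show "(\<integral>\<^sup>+z\<in>ball x r. ennreal \<bar>f z\<bar> \<partial>lebesgue) / ?m \<le> maximal h x + ennreal c" .
qed

text \<open>Let h keep the values of f above t/2 in modulus. Then |f| <= |h| + t/2, so exceeding t
  for f forces exceeding t/2 for h. The weak type bound for h at height t/2 explains the factor 2
  and sees only the large values of f.\<close>

lemma Pstar_restricted_weak_type:
  fixes f :: "'a::euclidean_space \<Rightarrow> real"
  assumes f[measurable]: "f \<in> borel_measurable lebesgue" and t: "t > 0"
  shows "emeasure lebesgue {x. ennreal t < Pstar f x}
    \<le> ennreal (2 * 5 ^ DIM('a) / t) * (\<integral>\<^sup>+z. ennreal \<bar>f z\<bar> * indicator {z. t < 2 * \<bar>f z\<bar>} z \<partial>lebesgue)"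
proof -
  define h where "h = (\<lambda>z. if t < 2 * \<bar>f z\<bar> then f z else 0)"
  have h[measurable]: "h \<in> borel_measurable lebesgue" unfolding h_def by measurable
  obtain U where U: "open U" "{x. ennreal (t / 2) < maximal h x} \<subseteq> U"
    "emeasure lebesgue U \<le> ennreal (5 ^ DIM('a) / (t / 2)) * (\<integral>\<^sup>+z. ennreal \<bar>h z\<bar> \<partial>lebesgue)"
    using maximal_weak_type[OF h, of "t / 2"] t by auto
  have "{x. ennreal t < Pstar f x} \<subseteq> {x. ennreal (t / 2) < maximal h x}"
  proof safe
    fix x assume "ennreal t < Pstar f x"
    also have "\<dots> \<le> maximal f x" by (rule Pstar_le_maximal[OF f])
    also have "\<dots> \<le> maximal h x + ennreal (t / 2)"
      using t by (intro maximal_le_add f h) (auto simp: h_def)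
    finally have *: "ennreal t < maximal h x + ennreal (t / 2)" .
    show "ennreal (t / 2) < maximal h x"
    proof (rule ccontr)
      assume "\<not> ?thesis"
      then have "maximal h x + ennreal (t / 2) \<le> ennreal (t / 2) + ennreal (t / 2)"
        by (intro add_right_mono) simp
      also have "\<dots> = ennreal t" using t by (simp add: ennreal_plus[symmetric] del: ennreal_plus)
      finally show False using * by simp
    qed
  qed
  then have "emeasure lebesgue {x. ennreal t < Pstar f x} \<le> emeasure lebesgue U"
    using U by (intro emeasure_mono) auto
  also note U(3)
  also have "(\<integral>\<^sup>+z. ennreal \<bar>h z\<bar> \<partial>lebesgue) = (\<integral>\<^sup>+z. ennreal \<bar>f z\<bar> * indicator {z. t < 2 * \<bar>f z\<bar>} z \<partial>lebesgue)"
    by (intro nn_integral_cong) (auto simp: h_def)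
  finally show ?thesis by (simp add: mult.commute)
qed


text \<open>Used with a = p - 2, for which a > -1 is precisely p > 1.\<close>

lemma nn_integral_powr_from_0:
  fixes a c :: real
  assumes "a > -1" "c \<ge> 0"
  shows "(\<integral>\<^sup>+t. ennreal (t powr a) * indicator {0..c} t \<partial>lborel) = ennreal (c powr (a + 1) / (a + 1))"
proof -
  have "((\<lambda>t. if t \<in> {0..c} then t powr a else 0) has_integral (c powr (a + 1) / (a + 1))) UNIV"
    unfolding has_integral_restrict_UNIV by (rule has_integral_powr_from_0[OF assms])
  then have "(\<integral>\<^sup>+t. ennreal (if t \<in> {0..c} then t powr a else 0) \<partial>lborel) = ennreal (c powr (a + 1) / (a + 1))"
    by (intro nn_integral_has_integral_lborel) auto
  moreover have "(\<integral>\<^sup>+t. ennreal (if t \<in> {0..c} then t powr a else 0) \<partial>lborel)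
      = (\<integral>\<^sup>+t. ennreal (t powr a) * indicator {0..c} t \<partial>lborel)"
    by (intro nn_integral_cong) (auto simp: indicator_def)
  ultimately show ?thesis by simp
qed

text \<open>\<open>layers p G\<close> is \<open>G\<^sup>p / p\<close>, written as an integral over levels.\<close>

definition layers :: "real \<Rightarrow> ennreal \<Rightarrow> ennreal" where
  "layers p G = (\<integral>\<^sup>+t. ennreal (t powr (p - 1)) * indicator {0<..} t * (if ennreal t < G then 1 else 0) \<partial>lborel)"

text \<open>Only the levels between b/2 and b are counted: the weight there is at least (b/2)^(p-1)
  and the interval has length b/2. This replaces the exact evaluation of the integral at the price
  of a factor \<open>2 powr p\<close> later on.\<close>

lemma layers_ge:
  fixes b p :: real
  assumes b: "b \<ge> 0" "ennreal b \<le> G" and p: "p > 1"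
  shows "ennreal ((b / 2) powr p) \<le> layers p G"
proof (cases "b = 0")
  case False
  then have b0: "b > 0" using b by simp
  have "(b / 2) powr p = (b / 2) powr (p - 1) * (b / 2)"
    using b0 powr_add[of "b / 2" "p - 1" 1] by simp
  then have "ennreal ((b / 2) powr p) = ennreal ((b / 2) powr (p - 1)) * ennreal (b / 2)"
    using b0 by (simp only: ennreal_mult'' less_imp_le half_gt_zero)
  also have "\<dots> = (\<integral>\<^sup>+t. ennreal ((b / 2) powr (p - 1)) * indicator {b/2<..<b} t \<partial>lborel)"
    using b0 by (subst nn_integral_cmult_indicator) auto
  also have "\<dots> \<le> layers p G"
    unfolding layers_def
  proof (intro nn_integral_mono)
    fix t :: real
    show "ennreal ((b / 2) powr (p - 1)) * indicator {b/2<..<b} t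
        \<le> ennreal (t powr (p - 1)) * indicator {0<..} t * (if ennreal t < G then 1 else 0)"
    proof (cases "t \<in> {b/2<..<b}")
      case True
      then have t: "b / 2 < t" "t < b" by auto
      have "(b / 2) powr (p - 1) \<le> t powr (p - 1)"
        using b0 t p by (intro powr_mono2) auto
      moreover have "ennreal t < G"
        using t b0 b(2) by (intro less_le_trans[OF _ b(2)] ennreal_lessI) auto
      ultimately show ?thesis using t b0 by (auto intro: ennreal_leI)
    qed simp
  qed
  finally show ?thesis .
qed (use p in auto)

lemma layers_top:
  assumes "p > 1" shows "layers p top = top"
proof (rule ccontr)
  assume "layers p top \<noteq> top"
  then obtain c where c: "layers p top = ennreal c" "c \<ge> 0" by (cases "layers p top") auto
  \<comment> \<open>Half of \<open>b\<close> is c + 1, and its p-th power is at least c + 1, which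
    exceeds the supposed finite value c.\<close>
  define b where "b = 2 * (c + 1)"
  have "(c + 1) powr 1 \<le> (c + 1) powr p" using c assms by (intro powr_mono) auto
  moreover have "ennreal ((c + 1) powr p) \<le> ennreal c"
    using layers_ge[of b top p] assms c unfolding b_def by (simp only: nonzero_mult_div_cancel_left) simp
  ultimately show False using c by (simp add: ennreal_le_iff)
qed

text \<open>Tonelli turns the left side into an integral over levels t of the measures of the level
  sets. After the truncated weak type bound a second exchange leaves, for each z, the integral of
  t^(p-2) over 0 < t < 2|f(z)|, which produces |f(z)|^p and the factor 1/(p-1).\<close>

lemma Pstar_layers_bound:
  fixes f :: "'a::euclidean_space \<Rightarrow> real"
  assumes f[measurable]: "f \<in> borel_measurable lebesgue" and P[measurable]: "Pstar f \<in> borel_measurable lebesgue"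
    and p: "p > 1"
  shows "(\<integral>\<^sup>+x. layers p (Pstar f x) \<partial>lebesgue)
    \<le> ennreal (2 powr p * 5 ^ DIM('a) / (p - 1)) * (\<integral>\<^sup>+x. ennreal (\<bar>f x\<bar> powr p) \<partial>lebesgue)"
proof -
  let ?c = "2 * 5 ^ DIM('a) :: real"
  define w where "w = (\<lambda>t::real. ennreal (t powr (p - 1)) * indicator {0<..} t)"
  have w[measurable]: "w \<in> borel_measurable borel" unfolding w_def by measurable
  have "(\<integral>\<^sup>+x. layers p (Pstar f x) \<partial>lebesgue)
      = (\<integral>\<^sup>+x. (\<integral>\<^sup>+t. w t * (if ennreal t < Pstar f x then 1 else 0) \<partial>lborel) \<partial>lebesgue)"
    by (simp add: layers_def w_def)
  also have "\<dots> = (\<integral>\<^sup>+t. (\<integral>\<^sup>+x. w t * (if ennreal t < Pstar f x then 1 else 0) \<partial>lebesgue) \<partial>lborel)"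
    by (intro lebesgue_lborel.Fubini'[symmetric]) measurable
  also have "\<dots> \<le> (\<integral>\<^sup>+t. (\<integral>\<^sup>+z. w t * ennreal (?c / t) * (ennreal \<bar>f z\<bar> * (if t < 2 * \<bar>f z\<bar> then 1 else 0)) \<partial>lebesgue) \<partial>lborel)"
  proof (rule nn_integral_mono)
    fix t :: real
    have lev: "{x. ennreal t < Pstar f x} \<in> sets lebesgue"
      using measurable_sets[OF P, of "{ennreal t<..}"] by (simp add: vimage_def)
    have "(\<integral>\<^sup>+x. w t * (if ennreal t < Pstar f x then 1 else 0) \<partial>lebesgue)
        = (\<integral>\<^sup>+x. w t * indicator {x. ennreal t < Pstar f x} x \<partial>lebesgue)"
      by (intro nn_integral_cong) (auto simp: indicator_def)
    also have "\<dots> = w t * emeasure lebesgue {x. ennreal t < Pstar f x}"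
      using lev by (rule nn_integral_cmult_indicator)
    also have "\<dots> \<le> w t * (ennreal (?c / t) * (\<integral>\<^sup>+z. ennreal \<bar>f z\<bar> * indicator {z. t < 2 * \<bar>f z\<bar>} z \<partial>lebesgue))"
    proof (cases "t > 0")
      case True
      then show ?thesis by (intro mult_left_mono Pstar_restricted_weak_type f) auto
    qed (simp add: w_def)
    also have "(\<integral>\<^sup>+z. ennreal \<bar>f z\<bar> * indicator {z. t < 2 * \<bar>f z\<bar>} z \<partial>lebesgue)
        = (\<integral>\<^sup>+z. ennreal \<bar>f z\<bar> * (if t < 2 * \<bar>f z\<bar> then 1 else 0) \<partial>lebesgue)"
      by (intro nn_integral_cong) (auto simp: indicator_def)
    also have "w t * (ennreal (?c / t) * \<dots>)
        = (\<integral>\<^sup>+z. w t * ennreal (?c / t) * (ennreal \<bar>f z\<bar> * (if t < 2 * \<bar>f z\<bar> then 1 else 0)) \<partial>lebesgue)"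
      by (subst nn_integral_cmult) (auto simp: mult.assoc)
    finally show "(\<integral>\<^sup>+x. w t * (if ennreal t < Pstar f x then 1 else 0) \<partial>lebesgue)
        \<le> (\<integral>\<^sup>+z. w t * ennreal (?c / t) * (ennreal \<bar>f z\<bar> * (if t < 2 * \<bar>f z\<bar> then 1 else 0)) \<partial>lebesgue)" .
  qed
  also have "\<dots> = (\<integral>\<^sup>+z. (\<integral>\<^sup>+t. w t * ennreal (?c / t) * (ennreal \<bar>f z\<bar> * (if t < 2 * \<bar>f z\<bar> then 1 else 0)) \<partial>lborel) \<partial>lebesgue)"
    by (intro lebesgue_lborel.Fubini') measurable
  also have "\<dots> \<le> (\<integral>\<^sup>+z. ennreal (2 powr p * 5 ^ DIM('a) / (p - 1)) * ennreal (\<bar>f z\<bar> powr p) \<partial>lebesgue)"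
  proof (rule nn_integral_mono)
    fix z
    have "(\<integral>\<^sup>+t. w t * ennreal (?c / t) * (ennreal \<bar>f z\<bar> * (if t < 2 * \<bar>f z\<bar> then 1 else 0)) \<partial>lborel)
        \<le> (\<integral>\<^sup>+t. ennreal (?c * \<bar>f z\<bar>) * (ennreal (t powr (p - 2)) * indicator {0..2 * \<bar>f z\<bar>} t) \<partial>lborel)"
    proof (rule nn_integral_mono)
      fix t :: real
      show "w t * ennreal (?c / t) * (ennreal \<bar>f z\<bar> * (if t < 2 * \<bar>f z\<bar> then 1 else 0))
        \<le> ennreal (?c * \<bar>f z\<bar>) * (ennreal (t powr (p - 2)) * indicator {0..2 * \<bar>f z\<bar>} t)"
      proof (cases "0 < t \<and> t < 2 * \<bar>f z\<bar>")
        case True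
        then have t: "t > 0" by simp
        have "t powr (p - 1) * (?c / t) * \<bar>f z\<bar> = ?c * \<bar>f z\<bar> * t powr (p - 2)"
          using t powr_diff[of t "p - 1" 1] by (simp add: field_simps)
        then have "ennreal (t powr (p - 1)) * ennreal (?c / t) * ennreal \<bar>f z\<bar>
            = ennreal (?c * \<bar>f z\<bar>) * ennreal (t powr (p - 2))"
          using t by (simp only: ennreal_mult[symmetric] powr_ge_zero abs_ge_zero mult_nonneg_nonneg
              divide_nonneg_pos zero_le_numeral zero_le_power)
        then show ?thesis using True by (simp add: w_def)
      qed (auto simp: w_def indicator_def)
    qed
    also have "\<dots> = ennreal (?c * \<bar>f z\<bar>) * ennreal ((2 * \<bar>f z\<bar>) powr (p - 2 + 1) / (p - 2 + 1))"
      using p by (subst nn_integral_cmult) (auto simp only: nn_integral_powr_from_0, auto)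
    also have "\<dots> = ennreal (?c * \<bar>f z\<bar> * ((2 * \<bar>f z\<bar>) powr (p - 1) / (p - 1)))"
      using p by (subst ennreal_mult[symmetric]) auto
    also have "?c * \<bar>f z\<bar> * ((2 * \<bar>f z\<bar>) powr (p - 1) / (p - 1)) = 2 powr p * 5 ^ DIM('a) / (p - 1) * \<bar>f z\<bar> powr p"
      by (cases "f z = 0") (simp_all add: powr_mult powr_diff)
    also have "ennreal \<dots> = ennreal (2 powr p * 5 ^ DIM('a) / (p - 1)) * ennreal (\<bar>f z\<bar> powr p)"
      using p by (intro ennreal_mult) auto
    finally show "(\<integral>\<^sup>+t. w t * ennreal (?c / t) * (ennreal \<bar>f z\<bar> * (if t < 2 * \<bar>f z\<bar> then 1 else 0)) \<partial>lborel)
        \<le> ennreal (2 powr p * 5 ^ DIM('a) / (p - 1)) * ennreal (\<bar>f z\<bar> powr p)" .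
  qed
  also have "\<dots> = ennreal (2 powr p * 5 ^ DIM('a) / (p - 1)) * (\<integral>\<^sup>+x. ennreal (\<bar>f x\<bar> powr p) \<partial>lebesgue)"
    by (rule nn_integral_cmult) measurable
  finally show ?thesis .
qed

lemma Pstar_strong_type:
  fixes f :: "'a::euclidean_space \<Rightarrow> real" and p :: real
  assumes p: "p > 1" and f: "in_Lp p f"
  defines "D \<equiv> 4 powr p * 5 ^ DIM('a) / (p - 1)"
  shows "AE x in lebesgue. Pstar f x < top" "in_Lp p (\<lambda>x. enn2real (Pstar f x))"
    "Lp_norm p (\<lambda>x. enn2real (Pstar f x)) \<le> D powr (1 / p) * Lp_norm p f"
proof -
  have [measurable]: "f \<in> borel_measurable lebesgue" and int: "integrable lebesgue (\<lambda>x. \<bar>f x\<bar> powr p)"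
    using f by (auto simp: in_Lp_def)
  have P[measurable]: "Pstar f \<in> borel_measurable lebesgue"
    using f p by (intro Pstar_measurable in_Lsum_Lp[of p]) auto
  let ?D = "2 powr p * 5 ^ DIM('a) / (p - 1)" and ?g = "\<lambda>x. enn2real (Pstar f x)"
  define T where "T = (\<integral>x. \<bar>f x\<bar> powr p \<partial>lebesgue)"
  have T: "T \<ge> 0" by (simp add: T_def)
  have D: "?D \<ge> 0" "D \<ge> 0" using p by (auto simp: D_def)
  have lay[measurable]: "(\<lambda>x. layers p (Pstar f x)) \<in> borel_measurable lebesgue"
    unfolding layers_def by measurable
  have "(\<integral>\<^sup>+x. layers p (Pstar f x) \<partial>lebesgue) \<le> ennreal ?D * (\<integral>\<^sup>+x. ennreal (\<bar>f x\<bar> powr p) \<partial>lebesgue)"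
    using p by (intro Pstar_layers_bound) auto
  also have "\<dots> = ennreal (?D * T)"
    using D T unfolding T_def by (subst nn_integral_eq_integral[OF int]) (simp_all only: ennreal_mult AE_I2 powr_ge_zero)
  finally have le: "(\<integral>\<^sup>+x. layers p (Pstar f x) \<partial>lebesgue) \<le> ennreal (?D * T)" .
  then have "(\<integral>\<^sup>+x. layers p (Pstar f x) \<partial>lebesgue) \<noteq> \<infinity>"
    by (auto simp: top_unique)
  then have "AE x in lebesgue. layers p (Pstar f x) \<noteq> \<infinity>"
    by (intro nn_integral_PInf_AE lay)
  \<comment> \<open>\<open>enn2real\<close> sends \<open>top\<close> to 0, so passing to real values
    would hide infinite values of \<open>Pstar f\<close>. An infinite value would make
    \<open>layers\<close> infinite, which the bound allows only on a null set.\<close>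
  then show fin: "AE x in lebesgue. Pstar f x < top"
    by eventually_elim (use layers_top[OF p] in \<open>metis infinity_ennreal_def less_top\<close>)
  have "(\<integral>\<^sup>+x. ennreal (\<bar>?g x\<bar> powr p) \<partial>lebesgue) \<le> (\<integral>\<^sup>+x. ennreal (2 powr p) * layers p (Pstar f x) \<partial>lebesgue)"
  proof (rule nn_integral_mono_AE)
    show "AE x in lebesgue. ennreal (\<bar>?g x\<bar> powr p) \<le> ennreal (2 powr p) * layers p (Pstar f x)"
      using fin
    proof eventually_elim
      case (elim x)
      have "\<bar>?g x\<bar> powr p = 2 powr p * (?g x / 2) powr p"
        by (simp add: powr_divide)
      then have "ennreal (\<bar>?g x\<bar> powr p) = ennreal (2 powr p) * ennreal ((?g x / 2) powr p)"
        by (simp add: ennreal_mult)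
      also have "\<dots> \<le> ennreal (2 powr p) * layers p (Pstar f x)"
        using elim p by (intro mult_left_mono layers_ge) auto
      finally show ?case .
    qed
  qed
  also have "\<dots> = ennreal (2 powr p) * (\<integral>\<^sup>+x. layers p (Pstar f x) \<partial>lebesgue)"
    by (rule nn_integral_cmult) measurable
  also have "\<dots> \<le> ennreal (2 powr p) * ennreal (?D * T)"
    using le by (rule mult_left_mono) simp
  also have "\<dots> = ennreal (D * T)"
  proof -
    \<comment> \<open>One factor \<open>2 powr p\<close> stems from truncating at half height, the
      other from the lower bound for \<open>layers\<close>; together they form the
      \<open>4 powr p\<close> in \<open>D\<close>.\<close>
    have "2 powr p * (?D * T) = D * T"
      by (simp add: D_def powr_mult[of 2 2 p, simplified] mult_ac)
    then show ?thesis using D T by (metis ennreal_mult' powr_ge_zero)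
  qed
  finally have main: "(\<integral>\<^sup>+x. ennreal (\<bar>?g x\<bar> powr p) \<partial>lebesgue) \<le> ennreal (D * T)" .
  have gint: "integrable lebesgue (\<lambda>x. \<bar>?g x\<bar> powr p)"
    by (rule integrableI_nonneg) (use main in \<open>auto simp: less_top[symmetric] top_unique\<close>)
  then show "in_Lp p ?g" by (simp add: in_Lp_def)
  have "(\<integral>x. \<bar>?g x\<bar> powr p \<partial>lebesgue) \<le> D * T"
    using main D T by (subst (asm) nn_integral_eq_integral[OF gint]) (auto simp: ennreal_le_iff)
  then have "Lp_norm p ?g \<le> (D * T) powr (1 / p)"
    unfolding Lp_norm_def using p by (intro powr_mono2) auto
  also have "\<dots> = D powr (1 / p) * Lp_norm p f"
    using D T by (simp add: powr_mult Lp_norm_def T_def)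
  finally show "Lp_norm p ?g \<le> D powr (1 / p) * Lp_norm p f" .
qed

section \<open>Concentration and almost everywhere convergence\<close>

lemma poisson_tail_le:
  fixes x :: "'a::euclidean_space"
  assumes "y > 0" "0 < \<sigma>" "\<sigma> < 2" "d > 0" and A: "A \<in> sets lebesgue" "A \<subseteq> {z. d \<le> dist x z}"
  shows "(\<integral>z. poisson \<sigma> y (x - z) * indicator A z \<partial>lebesgue)
    \<le> 2 powr (real DIM('a) / 2 + 1) * (y / d) powr \<sigma>"
proof -
  let ?b = "2 powr (real DIM('a) / 2 + 1) * (y / d) powr \<sigma>"
  have "ennreal (\<integral>z. poisson \<sigma> y (x - z) * indicator A z \<partial>lebesgue)
      = (\<integral>\<^sup>+z. ennreal (poisson \<sigma> y (x - z) * indicator A z) \<partial>lebesgue)"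
    using assms
    by (intro nn_integral_eq_integral[symmetric] integrable_real_mult_indicator integrable_poisson)
       (auto simp: poisson_nonneg)
  also have "\<dots> \<le> (\<integral>\<^sup>+z. ennreal (poisson \<sigma> y (x - z)) * indicator {z. d \<le> dist x z} z \<partial>lebesgue)"
    using A(2) by (intro nn_integral_mono) (auto simp: indicator_def)
  also have "\<dots> \<le> ennreal ?b"
    using assms by (intro nn_integral_poisson_tail) auto
  finally show ?thesis by (simp add: ennreal_le_iff)
qed

text \<open>The pointwise counterpart of the tail estimate, needed for data that are integrable but
  unbounded. The bound \<sigma> < 2 is used twice to remove \<sigma> from the constant: in the
  exponent (n + \<sigma>)/2 and through 1/\<sigma> >= 1/2 in the lower bound for
  I(\<sigma>).\<close>

lemma poisson_far_le:
  fixes w :: "'a::euclidean_space"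
  assumes "y > 0" "0 < \<sigma>" "\<sigma> < 2" "d > 0" "d \<le> norm w"
  shows "poisson \<sigma> y w \<le> 2 powr (real DIM('a) / 2 + 2) / (sphere_area DIM('a) * d ^ DIM('a)) * (y / d) powr \<sigma>"
proof -
  let ?n = "DIM('a)" and ?I = "I_const DIM('a) \<sigma>" and ?w = "sphere_area DIM('a)"
  have Ipos: "?I > 0" and wpos: "?w > 0" using assms by (auto simp: I_const_pos sphere_area_pos)
  have "(y\<^sup>2 + (norm w)\<^sup>2) powr (- (real ?n + \<sigma>) / 2) \<le> (d\<^sup>2) powr (- (real ?n + \<sigma>) / 2)"
    using assms by (intro powr_mono2') (auto simp: add_increasing power_mono)
  also have "\<dots> = d powr (- (real ?n + \<sigma>))" using assms by (intro square_powr)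
  also have "\<dots> = d powr (-\<sigma>) / d ^ ?n"
    using assms by (simp add: powr_diff powr_realpow[symmetric] powr_minus powr_add field_simps)
  finally have 1: "(y\<^sup>2 + (norm w)\<^sup>2) powr (- (real ?n + \<sigma>) / 2) \<le> d powr (-\<sigma>) / d ^ ?n" .
  have "?w * 2 powr (- (real ?n / 2 + 2)) \<le> ?w * (2 powr (- (real ?n + \<sigma>) / 2) / \<sigma>)"
  proof (rule mult_left_mono)
    have e: "- (real ?n / 2 + 2) = - (real ?n / 2 + 1) - 1" by simp
    have "2 powr (- (real ?n / 2 + 2)) = 2 powr (- (real ?n / 2 + 1)) / (2::real)"
      unfolding e by (subst powr_diff) simp
    also have "\<dots> \<le> 2 powr (- (real ?n + \<sigma>) / 2) / \<sigma>"
      using assms by (intro frac_le powr_mono) auto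
    finally show "2 powr (- (real ?n / 2 + 2)) \<le> 2 powr (- (real ?n + \<sigma>) / 2) / \<sigma>" .
  qed (use wpos in auto)
  also have "\<dots> \<le> ?I" using assms by (intro I_const_lower) auto
  finally have 2: "1 / ?I \<le> 2 powr (real ?n / 2 + 2) / ?w"
    using Ipos wpos by (simp add: powr_minus field_simps)
  have "poisson \<sigma> y w = y powr \<sigma> * ((y\<^sup>2 + (norm w)\<^sup>2) powr (- (real ?n + \<sigma>) / 2) * (1 / ?I))"
    by (simp add: poisson_def)
  also have "\<dots> \<le> y powr \<sigma> * ((d powr (-\<sigma>) / d ^ ?n) * (2 powr (real ?n / 2 + 2) / ?w))"
    using 1 2 assms Ipos by (intro mult_left_mono mult_mono) auto
  also have "\<dots> = 2 powr (real ?n / 2 + 2) / (?w * d ^ ?n) * (y / d) powr \<sigma>"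
    using assms by (simp add: powr_divide powr_minus field_simps)
  finally show ?thesis .
qed

text \<open>A kernel of mass 1 averages, and the integral does not see the exceptional null set, so
  the bound holds at every point x.\<close>

lemma Pstar_le_Linf:
  assumes "AE x in lebesgue. \<bar>f x\<bar> \<le> K"
  shows "Pstar f x \<le> ennreal K"
  unfolding Pstar_def
proof (rule SUP_least)
  fix q :: "real \<times> real" assume "q \<in> {0<..} \<times> {0<..<2}"
  then have q: "fst q > 0" "snd q > 0" by auto
  let ?P = "\<lambda>z. poisson (snd q) (fst q) (x - z)"
  have "ennreal \<bar>conv (poisson (snd q) (fst q)) f x\<bar> \<le> (\<integral>\<^sup>+z. ennreal (?P z) * ennreal \<bar>f z\<bar> \<partial>lebesgue)"
    using q by (intro ennreal_abs_conv_le)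
  also have "\<dots> \<le> (\<integral>\<^sup>+z. ennreal (?P z) * ennreal K \<partial>lebesgue)"
    using assms by (intro nn_integral_mono_AE) (auto elim!: eventually_mono intro!: mult_left_mono ennreal_leI)
  also have "\<dots> = (\<integral>\<^sup>+z. ennreal (?P z) \<partial>lebesgue) * ennreal K"
    by (rule nn_integral_multc) measurable
  also have "\<dots> = ennreal K" using q by (simp add: nn_integral_poisson)
  finally show "ennreal \<bar>conv (poisson (snd q) (fst q)) f x\<bar> \<le> ennreal K" .
qed

text \<open>Regularity puts A between a closed F and an open U with little measure in between, and a
  Urysohn function for F and the complement of U differs from the indicator only there. Boundedness
  and continuity are what the convergence at continuity points asks of \<phi>.\<close>

lemma indicator_L1_approx_continuous:
  fixes A :: "'a::euclidean_space set" and e :: real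
  assumes A: "A \<in> sets lebesgue" and e: "e > 0"
  obtains \<phi> :: "'a \<Rightarrow> real" where "continuous_on UNIV \<phi>" "\<And>x. 0 \<le> \<phi> x" "\<And>x. \<phi> x \<le> 1"
    "integrable lebesgue (\<lambda>x. indicator A x - \<phi> x)" "(\<integral>x. \<bar>indicator A x - \<phi> x\<bar> \<partial>lebesgue) \<le> e"
proof -
  obtain U where U: "open U" "A \<subseteq> U" "U - A \<in> lmeasurable" "emeasure lebesgue (U - A) < ennreal (e / 2)"
    using sets_lebesgue_outer_open[OF A, of "e / 2"] e by auto
  obtain F where F: "closed F" "F \<subseteq> A" "A - F \<in> lmeasurable" "emeasure lebesgue (A - F) < ennreal (e / 2)"
    using sets_lebesgue_inner_closed[OF A, of "e / 2"] e by auto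
  obtain \<phi> :: "'a \<Rightarrow> real" where \<phi>: "continuous_on UNIV \<phi>" "\<And>x. \<phi> x \<in> closed_segment 1 0"
    "\<And>x. x \<in> F \<Longrightarrow> \<phi> x = 1" "\<And>x. x \<in> - U \<Longrightarrow> \<phi> x = 0"
    using Urysohn[of F "- U" "1::real" 0] U F by blast
  have rng: "0 \<le> \<phi> x" "\<phi> x \<le> 1" for x using \<phi>(2)[of x] by (auto simp: closed_segment_eq_real_ivl)
  define B where "B = (U - A) \<union> (A - F)"
  have B: "B \<in> lmeasurable" unfolding B_def using U F by blast
  have "measure lebesgue B \<le> measure lebesgue (U - A) + measure lebesgue (A - F)"
    unfolding B_def using U F by (intro measure_Un_le) auto
  also have "measure lebesgue (U - A) \<le> e / 2"
    using U(4) e unfolding measure_def by (intro enn2real_leI) auto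
  also have "measure lebesgue (A - F) \<le> e / 2"
    using F(4) e unfolding measure_def by (intro enn2real_leI) auto
  finally have mB: "measure lebesgue B \<le> e" by simp
  have le: "\<bar>indicator A x - \<phi> x\<bar> \<le> indicator B x" for x
    using \<phi>(3)[of x] \<phi>(4)[of x] rng[of x] U(2) F(2) by (auto simp: B_def indicator_def)
  have \<phi>m: "\<phi> \<in> borel_measurable lebesgue"
    using \<phi>(1) by (intro measurable_completion) (simp add: borel_measurable_continuous_onI)
  have int: "integrable lebesgue (\<lambda>x. indicator A x - \<phi> x)"
    by (rule Bochner_Integration.integrable_bound[where f = "indicator B :: 'a \<Rightarrow> real"])
       (use B A \<phi>m le in \<open>auto simp: fmeasurable_def\<close>)
  have "(\<integral>x. \<bar>indicator A x - \<phi> x\<bar> \<partial>lebesgue) \<le> (\<integral>x. indicator B x \<partial>lebesgue)"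
    using int B le by (intro integral_mono integrable_abs) (auto simp: fmeasurable_def)
  also have "\<dots> \<le> e" using mB B by simp
  finally show ?thesis using that[OF \<phi>(1) rng int] by simp
qed

section \<open>Exponents depending on y: concentration at the origin\<close>

locale concentrating =
  fixes Sg :: "real \<Rightarrow> real"
  assumes Sg: "\<And>y. y > 0 \<Longrightarrow> 0 < Sg y" "\<And>y. y > 0 \<Longrightarrow> Sg y < 2"
    and Sg_lim: "filterlim (\<lambda>y. Sg y * ln y) at_bot (at_right 0)"
begin

text \<open>The power splits as exp(Sg y * ln y) times exp(- Sg y * ln d). The first factor tends to
  0 by hypothesis; the second stays below exp(2 |ln d|) since \<open>Sg y\<close> < 2.\<close>

lemma powr_Sg_tendsto_0:
  assumes d: "d > 0" shows "((\<lambda>y. (y / d) powr Sg y) \<longlongrightarrow> 0) (at_right 0)"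
proof (rule tendsto_sandwich[OF _ _ tendsto_const])
  have "((\<lambda>y. exp (Sg y * ln y)) \<longlongrightarrow> 0) (at_right 0)"
    by (rule filterlim_compose[OF exp_at_bot Sg_lim])
  then show "((\<lambda>y. exp (2 * \<bar>ln d\<bar>) * exp (Sg y * ln y)) \<longlongrightarrow> 0) (at_right 0)"
    by (rule tendsto_mult_right_zero)
  show "\<forall>\<^sub>F y in at_right 0. (y / d) powr Sg y \<le> exp (2 * \<bar>ln d\<bar>) * exp (Sg y * ln y)"
    using eventually_at_right_less[of 0]
  proof eventually_elim
    case (elim y)
    have "- (Sg y * ln d) \<le> \<bar>Sg y\<bar> * \<bar>ln d\<bar>" by (metis abs_ge_minus_self abs_mult)
    also have "\<dots> \<le> 2 * \<bar>ln d\<bar>" using Sg[OF elim] by (intro mult_right_mono) auto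
    finally have "Sg y * (ln y - ln d) \<le> 2 * \<bar>ln d\<bar> + Sg y * ln y" by (simp add: algebra_simps)
    then show ?case using elim d by (simp add: powr_def ln_div exp_add[symmetric])
  qed
qed (auto intro!: always_eventually)

lemma tail_tendsto_0:
  fixes x :: "'a::euclidean_space"
  assumes "d > 0" "A \<in> sets lebesgue" "A \<subseteq> {z. d \<le> dist x z}"
  shows "((\<lambda>y. \<integral>z. poisson (Sg y) y (x - z) * indicator A z \<partial>lebesgue) \<longlongrightarrow> 0) (at_right 0)"
proof (rule tendsto_sandwich[OF _ _ tendsto_const tendsto_mult_right_zero[OF powr_Sg_tendsto_0[OF assms(1)]]])
  show "\<forall>\<^sub>F y in at_right 0. 0 \<le> (\<integral>z. poisson (Sg y) y (x - z) * indicator A z \<partial>lebesgue)"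
    using eventually_at_right_less[of 0]
    by eventually_elim (auto intro!: integral_nonneg simp: poisson_nonneg Sg)
  show "\<forall>\<^sub>F y in at_right 0. (\<integral>z. poisson (Sg y) y (x - z) * indicator A z \<partial>lebesgue)
      \<le> 2 powr (real DIM('a) / 2 + 1) * (y / d) powr Sg y"
    using eventually_at_right_less[of 0]
    by eventually_elim (intro poisson_tail_le Sg assms)
qed

text \<open>Mass 1 moves g(x) under the integral. The difference g(z) - g(x) is below e/2 near x by
  continuity and at most 2 K elsewhere, where only the vanishing tail mass counts.\<close>

lemma conv_tendsto_at_continuity_point:
  fixes g :: "'a::euclidean_space \<Rightarrow> real"
  assumes g: "g \<in> borel_measurable lebesgue" "\<And>z. \<bar>g z\<bar> \<le> K" and cont: "isCont g x"
  shows "((\<lambda>y. conv (poisson (Sg y) y) g x) \<longlongrightarrow> g x) (at_right 0)"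
proof (rule tendstoI)
  fix e :: real assume e: "e > 0"
  obtain d where d: "d > 0" "\<And>z. dist z x < d \<Longrightarrow> dist (g z) (g x) < e / 2"
    using cont[unfolded continuous_at_eps_delta] e by (metis half_gt_zero)
  define A where "A = {z. d \<le> dist x z}"
  have A: "A \<in> sets lebesgue" unfolding A_def by (simp add: closed_Collect_le continuous_intros)
  have K: "K \<ge> 0" using g(2)[of 0] by linarith
  have "((\<lambda>y. e / 2 + 2 * K * (\<integral>z. poisson (Sg y) y (x - z) * indicator A z \<partial>lebesgue)) \<longlongrightarrow> e / 2 + 2 * K * 0) (at_right 0)"
    by (intro tendsto_intros tail_tendsto_0[OF d(1) A]) (simp add: A_def)
  then have "\<forall>\<^sub>F y in at_right 0. e / 2 + 2 * K * (\<integral>z. poisson (Sg y) y (x - z) * indicator A z \<partial>lebesgue) < e"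
    by (rule order_tendstoD) (use e in simp)
  then show "\<forall>\<^sub>F y in at_right 0. dist (conv (poisson (Sg y) y) g x) (g x) < e"
    using eventually_at_right_less[of 0]
  proof eventually_elim
    case (elim y)
    let ?P = "\<lambda>z. poisson (Sg y) y (x - z)"
    have Pn: "?P z \<ge> 0" for z using Sg[OF elim(2)] by (simp add: poisson_nonneg)
    have Pi: "integrable lebesgue ?P" "integral\<^sup>L lebesgue ?P = 1"
      using integrable_poisson[OF elim(2) Sg(1)[OF elim(2)]] by auto
    have Pg: "integrable lebesgue (\<lambda>z. ?P z * g z)"
      using g elim(2) by (intro integrable_poisson_mult Sg in_Lsum_bounded[where K = K]) auto
    have "conv (poisson (Sg y) y) g x - g x = (\<integral>z. ?P z * g z \<partial>lebesgue) - (\<integral>z. ?P z * g x \<partial>lebesgue)"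
      using Pi by (simp add: conv_def)
    also have "\<dots> = (\<integral>z. ?P z * g z - ?P z * g x \<partial>lebesgue)"
      using Pg Pi by (intro Bochner_Integration.integral_diff[symmetric]) auto
    finally have "\<bar>conv (poisson (Sg y) y) g x - g x\<bar> = \<bar>\<integral>z. ?P z * g z - ?P z * g x \<partial>lebesgue\<bar>"
      by simp
    also have "\<dots> \<le> (\<integral>z. \<bar>?P z * g z - ?P z * g x\<bar> \<partial>lebesgue)"
      by (rule integral_abs_bound)
    also have "\<dots> \<le> (\<integral>z. e / 2 * ?P z + 2 * K * (?P z * indicator A z) \<partial>lebesgue)"
    proof (rule integral_mono)
      show "integrable lebesgue (\<lambda>z. \<bar>?P z * g z - ?P z * g x\<bar>)" using Pg Pi by auto
      show "integrable lebesgue (\<lambda>z. e / 2 * ?P z + 2 * K * (?P z * indicator A z))"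
        using Pi A by (intro Bochner_Integration.integrable_add integrable_mult_right integrable_real_mult_indicator)
      fix z
      have "\<bar>g z - g x\<bar> \<le> e / 2 + 2 * K * indicator A z"
      proof (cases "z \<in> A")
        case True
        then show ?thesis using g(2)[of z] g(2)[of x] e by simp
      next
        case False
        then show ?thesis using d(2)[of z] by (simp add: A_def dist_real_def dist_commute)
      qed
      then have "?P z * \<bar>g z - g x\<bar> \<le> ?P z * (e / 2 + 2 * K * indicator A z)"
        using Pn by (rule mult_left_mono)
      moreover have "\<bar>?P z * g z - ?P z * g x\<bar> = ?P z * \<bar>g z - g x\<bar>"
        using Pn[of z] by (simp add: right_diff_distrib[symmetric] abs_mult)
      ultimately show "\<bar>?P z * g z - ?P z * g x\<bar> \<le> e / 2 * ?P z + 2 * K * (?P z * indicator A z)"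
        by (simp add: algebra_simps)
    qed
    also have "\<dots> = e / 2 + 2 * K * (\<integral>z. ?P z * indicator A z \<partial>lebesgue)"
      using Pi A by (subst Bochner_Integration.integral_add) (auto intro!: integrable_real_mult_indicator)
    also have "\<dots> < e" by (rule elim(1))
    finally show ?case by (simp add: dist_real_def)
  qed
qed

text \<open>Of the majorant K + g, the constant is paired with the tail mass of the kernel and g
  with its supremum away from x. Both are controlled by (y/d)^(Sg y).\<close>

lemma conv_far_tendsto_0:
  fixes f :: "'a::euclidean_space \<Rightarrow> real"
  assumes f: "in_Lsum f" and d: "d > 0" and zero: "\<And>z. dist x z < d \<Longrightarrow> f z = 0"
  shows "((\<lambda>y. conv (poisson (Sg y) y) f x) \<longlongrightarrow> 0) (at_right 0)"
proof -
  have [measurable]: "f \<in> borel_measurable lebesgue" using f by (rule in_Lsum_measurable)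
  obtain K g where g: "integrable lebesgue g" "AE z in lebesgue. \<bar>f z\<bar> \<le> K + g z"
    using f by (auto simp: in_Lsum_def)
  define A where "A = {z. d \<le> dist x z}"
  have A: "A \<in> sets lebesgue" unfolding A_def by (simp add: closed_Collect_le continuous_intros)
  define c where "c = 2 powr (real DIM('a) / 2 + 2) / (sphere_area DIM('a) * d ^ DIM('a))"
  let ?T = "\<lambda>y. \<bar>K\<bar> * (\<integral>z. poisson (Sg y) y (x - z) * indicator A z \<partial>lebesgue)
      + c * (y / d) powr Sg y * (\<integral>z. \<bar>g z\<bar> \<partial>lebesgue)"
  show ?thesis
  proof (rule Lim_null_comparison)
    have "(?T \<longlongrightarrow> \<bar>K\<bar> * 0 + c * 0 * (\<integral>z. \<bar>g z\<bar> \<partial>lebesgue)) (at_right 0)"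
      by (intro tendsto_intros tail_tendsto_0[OF d A] powr_Sg_tendsto_0 d) (simp add: A_def)
    then show "(?T \<longlongrightarrow> 0) (at_right 0)" by simp
    show "\<forall>\<^sub>F y in at_right 0. norm (conv (poisson (Sg y) y) f x) \<le> ?T y"
      using eventually_at_right_less[of 0]
    proof eventually_elim
      case (elim y)
      let ?P = "\<lambda>z. poisson (Sg y) y (x - z)"
      have Pn: "?P z \<ge> 0" for z using Sg[OF elim] by (simp add: poisson_nonneg)
      have Pi: "integrable lebesgue ?P" "integral\<^sup>L lebesgue ?P = 1"
        using integrable_poisson[OF elim Sg(1)[OF elim]] by auto
      have "norm (conv (poisson (Sg y) y) f x) \<le> (\<integral>z. \<bar>?P z * f z\<bar> \<partial>lebesgue)"
        unfolding conv_def real_norm_def by (rule integral_abs_bound)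
      also have "\<dots> \<le> (\<integral>z. \<bar>K\<bar> * (?P z * indicator A z) + c * (y / d) powr Sg y * \<bar>g z\<bar> \<partial>lebesgue)"
      proof (rule integral_mono_AE)
        show "integrable lebesgue (\<lambda>z. \<bar>?P z * f z\<bar>)"
          using f elim by (intro integrable_abs integrable_poisson_mult Sg)
        show "integrable lebesgue (\<lambda>z. \<bar>K\<bar> * (?P z * indicator A z) + c * (y / d) powr Sg y * \<bar>g z\<bar>)"
          using Pi A g by (intro Bochner_Integration.integrable_add integrable_mult_right
              integrable_real_mult_indicator integrable_abs)
        show "AE z in lebesgue. \<bar>?P z * f z\<bar> \<le> \<bar>K\<bar> * (?P z * indicator A z) + c * (y / d) powr Sg y * \<bar>g z\<bar>"
          using g(2)
        proof eventually_elim
          case (elim z)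
          have y: "y > 0" by fact
          show ?case
          proof (cases "z \<in> A")
            case True
            have "\<bar>f z\<bar> \<le> \<bar>K\<bar> + \<bar>g z\<bar>" using elim by linarith
            then have "?P z * \<bar>f z\<bar> \<le> ?P z * (\<bar>K\<bar> + \<bar>g z\<bar>)"
              using Pn by (rule mult_left_mono)
            moreover have "?P z * \<bar>g z\<bar> \<le> c * (y / d) powr Sg y * \<bar>g z\<bar>"
              unfolding c_def using True y d
              by (intro mult_right_mono poisson_far_le Sg) (auto simp: A_def dist_norm)
            ultimately show ?thesis using True Pn[of z] by (simp add: abs_mult algebra_simps)
          next
            case False
            then have "f z = 0" by (intro zero) (simp add: A_def)
            moreover have "c \<ge> 0" using sphere_area_pos[of "DIM('a)"] d by (simp add: c_def)
            ultimately show ?thesis using False by simp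
          qed
        qed
      qed
      also have "\<dots> = ?T y"
        using Pi A g by (subst Bochner_Integration.integral_add) (auto intro!: integrable_real_mult_indicator)
      finally show ?case .
    qed
  qed
qed


section \<open>Almost everywhere convergence\<close>

text \<open>With h = f - g, the error for f is at most the convolution of h, plus the error for g,
  plus |h(x)|, each kept below or at d/3. The first is handled by the weak type bound and is uniform
  in y, the second by convergence for g, the third by Chebyshev's inequality.\<close>

lemma conv_tendsto_of_approx:
  fixes f :: "'a::euclidean_space \<Rightarrow> real"
  assumes f: "in_Lsum f"
    and approx: "\<And>e. e > 0 \<Longrightarrow> \<exists>g. in_Lsum g \<and> integrable lebesgue (\<lambda>z. f z - g z) \<and>
      (\<integral>z. \<bar>f z - g z\<bar> \<partial>lebesgue) \<le> e \<and>
      (AE x in lebesgue. ((\<lambda>y. conv (poisson (Sg y) y) g x) \<longlongrightarrow> g x) (at_right 0))"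
  shows "AE x in lebesgue. ((\<lambda>y. conv (poisson (Sg y) y) f x) \<longlongrightarrow> f x) (at_right 0)"
proof -
  \<comment> \<open>Since y runs through a continuum, no measurability of \<open>bad d\<close> is at
    hand. It is shown negligible by covering it with measurable sets of arbitrarily small
    measure.\<close>
  define bad where "bad = (\<lambda>d::real. {x. \<not> (\<forall>\<^sub>F y in at_right 0. \<bar>conv (poisson (Sg y) y) f x - f x\<bar> < d)})"
  have bad: "negligible (bad d)" if d: "d > 0" for d
    unfolding negligible_outer_le
  proof (intro allI impI)
    fix e :: real assume e: "e > 0"
    let ?q = "5 ^ DIM('a) :: real"
    \<comment> \<open>\<open>U\<close> will have measure at most \<open>3 * ?q * e' / d\<close> by
      the weak type bound at height d/3, and \<open>V\<close> at most \<open>3 * e' / d\<close>;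
      this choice makes the two add up to \<open>e\<close>.\<close>
    define e' where "e' = e * d / (3 * (?q + 1))"
    have e': "e' > 0" using e d by (simp add: e'_def add_pos_pos)
    obtain g where g: "in_Lsum g" "integrable lebesgue (\<lambda>z. f z - g z)"
        "(\<integral>z. \<bar>f z - g z\<bar> \<partial>lebesgue) \<le> e'"
        "AE x in lebesgue. ((\<lambda>y. conv (poisson (Sg y) y) g x) \<longlongrightarrow> g x) (at_right 0)"
      using approx[OF e'] by blast
    define h where "h = (\<lambda>z. f z - g z)"
    have hi: "integrable lebesgue h" using g(2) by (simp add: h_def)
    have hm[measurable]: "h \<in> borel_measurable lebesgue" using hi by (rule borel_measurable_integrable)
    have hn: "(\<integral>\<^sup>+z. ennreal \<bar>h z\<bar> \<partial>lebesgue) \<le> ennreal e'"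
      using g(3) hi by (subst nn_integral_eq_integral) (auto simp: h_def intro!: ennreal_leI)
    obtain U where U: "open U" "{x. ennreal (d / 3) < maximal h x} \<subseteq> U"
      "emeasure lebesgue U \<le> ennreal (?q / (d / 3)) * (\<integral>\<^sup>+z. ennreal \<bar>h z\<bar> \<partial>lebesgue)"
      using maximal_weak_type[OF hm, of "d / 3"] d by auto
    define V where "V = {x. d / 3 \<le> \<bar>h x\<bar>}"
    have V: "V \<in> sets lebesgue"
    proof -
      have "V = {x \<in> space lebesgue. d / 3 \<le> \<bar>h x\<bar>}" by (simp add: V_def)
      also have "\<dots> \<in> sets lebesgue" by measurable
      finally show ?thesis .
    qed
    have U_le: "emeasure lebesgue U \<le> ennreal (?q * 3 / d * e')"
    proof -
      note U(3)
      also have "ennreal (?q / (d / 3)) * (\<integral>\<^sup>+z. ennreal \<bar>h z\<bar> \<partial>lebesgue) \<le> ennreal (?q / (d / 3)) * ennreal e'"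
        using hn by (rule mult_left_mono) simp
      also have "\<dots> = ennreal (?q * 3 / d * e')"
        using d e' by (simp add: ennreal_mult[symmetric])
      finally show ?thesis .
    qed
    have V_le: "emeasure lebesgue V \<le> ennreal (3 / d * e')"
    proof -
      have "emeasure lebesgue V = (\<integral>\<^sup>+z. indicator V z \<partial>lebesgue)" using V by simp
      also have "\<dots> \<le> (\<integral>\<^sup>+z. ennreal (3 / d) * ennreal \<bar>h z\<bar> \<partial>lebesgue)"
      proof (rule nn_integral_mono)
        fix z
        show "indicator V z \<le> ennreal (3 / d) * ennreal \<bar>h z\<bar>"
        proof (cases "z \<in> V")
          case True
          then have "1 \<le> 3 / d * \<bar>h z\<bar>" using d by (simp add: V_def field_simps)
          then have "ennreal 1 \<le> ennreal (3 / d * \<bar>h z\<bar>)" by (rule ennreal_leI)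
          also have "\<dots> = ennreal (3 / d) * ennreal \<bar>h z\<bar>" using d by (intro ennreal_mult) auto
          finally show ?thesis using True by simp
        qed simp
      qed
      also have "\<dots> = ennreal (3 / d) * (\<integral>\<^sup>+z. ennreal \<bar>h z\<bar> \<partial>lebesgue)"
        by (rule nn_integral_cmult) measurable
      also have "\<dots> \<le> ennreal (3 / d) * ennreal e'"
        using hn by (rule mult_left_mono) simp
      also have "\<dots> = ennreal (3 / d * e')" using d e' by (intro ennreal_mult[symmetric]) auto
      finally show ?thesis .
    qed
    obtain N where N: "N \<in> null_sets lebesgue"
      "{x \<in> space lebesgue. \<not> ((\<lambda>y. conv (poisson (Sg y) y) g x) \<longlongrightarrow> g x) (at_right 0)} \<subseteq> N"
      using g(4) by (auto simp: eventually_ae_filter)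
    let ?T = "U \<union> V \<union> N"
    have T: "?T \<in> sets lebesgue" using U(1) V null_setsD2[OF N(1)] by (intro sets.Un) auto
    have "emeasure lebesgue ?T \<le> emeasure lebesgue (U \<union> V) + emeasure lebesgue N"
      using U(1) V null_setsD2[OF N(1)] by (intro emeasure_subadditive sets.Un) auto
    also have "\<dots> = emeasure lebesgue (U \<union> V)" using null_setsD1[OF N(1)] by simp
    also have "\<dots> \<le> emeasure lebesgue U + emeasure lebesgue V"
      using U(1) V by (intro emeasure_subadditive) auto
    also have "\<dots> \<le> ennreal (?q * 3 / d * e') + ennreal (3 / d * e')"
      by (intro add_mono U_le V_le)
    also have "\<dots> = ennreal (?q * 3 / d * e' + 3 / d * e')"
      using d e' by (intro ennreal_plus[symmetric]) auto
    also have "?q * 3 / d * e' + 3 / d * e' = 3 * (?q + 1) * e' / d"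
      by (simp add: add_divide_distrib algebra_simps)
    also have "\<dots> = e"
    proof -
      have "3 * (?q + 1) \<noteq> 0" by (smt (verit) zero_less_power)
      then show ?thesis using d unfolding e'_def by simp
    qed
    finally have T_le: "emeasure lebesgue ?T \<le> ennreal e" .
    show "\<exists>T. bad d \<subseteq> T \<and> T \<in> lmeasurable \<and> measure lebesgue T \<le> e"
    proof (intro exI[of _ ?T] conjI)
      show "?T \<in> lmeasurable"
        using T T_le by (intro fmeasurableI) (auto simp del: emeasure_completion intro: le_less_trans)
      show "measure lebesgue ?T \<le> e"
        using T_le e unfolding measure_def by (intro enn2real_leI) auto
      show "bad d \<subseteq> ?T"
      proof (rule ccontr)
        assume "\<not> bad d \<subseteq> ?T"
        then obtain x where x: "x \<in> bad d" "x \<notin> U" "x \<notin> V" "x \<notin> N" by auto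
        have "((\<lambda>y. conv (poisson (Sg y) y) g x) \<longlongrightarrow> g x) (at_right 0)" using N(2) x(4) by auto
        then have "\<forall>\<^sub>F y in at_right 0. dist (conv (poisson (Sg y) y) g x) (g x) < d / 3"
          by (rule tendstoD) (use d in simp)
        then have "\<forall>\<^sub>F y in at_right 0. \<bar>conv (poisson (Sg y) y) f x - f x\<bar> < d"
          using eventually_at_right_less[of 0]
        proof eventually_elim
          case (elim y)
          have "conv (poisson (Sg y) y) h x = conv (poisson (Sg y) y) f x - conv (poisson (Sg y) y) g x"
            unfolding conv_def h_def right_diff_distrib
            using elim(2) f g(1) by (intro Bochner_Integration.integral_diff integrable_poisson_mult Sg)
          moreover have "\<bar>conv (poisson (Sg y) y) h x\<bar> \<le> d / 3"
          proof -
            have "ennreal \<bar>conv (poisson (Sg y) y) h x\<bar> \<le> maximal h x"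
              using elim(2) Sg
              by (intro order_trans[OF ennreal_abs_conv_le nn_integral_poisson_le_maximal] hm) auto
            also have "\<dots> \<le> ennreal (d / 3)" using U(2) x(2) by (meson mem_Collect_eq not_le subset_iff)
            finally show ?thesis using d by (simp add: ennreal_le_iff)
          qed
          moreover have "\<bar>h x\<bar> < d / 3" using x(3) by (simp add: V_def)
          moreover have "\<bar>conv (poisson (Sg y) y) g x - g x\<bar> < d / 3" using elim(1) by (simp add: dist_real_def)
          ultimately show ?case by (simp add: h_def abs_if split: if_splits)
        qed
        then show False using x(1) by (simp add: bad_def)
      qed
    qed
  qed
  \<comment> \<open>A sequence of tolerances tending to 0 suffices, so only countably many null sets
    are united.\<close>
  have "AE x in lebesgue. \<forall>k::nat. x \<notin> bad (1 / Suc k)"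
    unfolding AE_all_countable
    by (intro allI AE_not_in) (use bad in \<open>auto simp: negligible_iff_null_sets[symmetric]\<close>)
  then show ?thesis
  proof eventually_elim
    case (elim x)
    show ?case
    proof (rule tendstoI)
      fix e :: real assume "e > 0"
      then obtain k :: nat where k: "1 / Suc k < e"
        using nat_approx_posE by blast
      have "\<forall>\<^sub>F y in at_right 0. \<bar>conv (poisson (Sg y) y) f x - f x\<bar> < 1 / Suc k"
        using elim by (simp add: bad_def)
      then show "\<forall>\<^sub>F y in at_right 0. dist (conv (poisson (Sg y) y) f x) (f x) < e"
        by eventually_elim (use k in \<open>simp add: dist_real_def\<close>)
    qed
  qed
qed

text \<open>The induction runs through indicators, sums and dominated limits. Indicators are
  approximated by bounded continuous functions and limits by their approximating sequence in L^1, so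
  both reduce to the approximation principle; sums need only linearity.\<close>

lemma conv_tendsto_integrable:
  fixes f :: "'a::euclidean_space \<Rightarrow> real"
  assumes "integrable lebesgue f"
  shows "AE x in lebesgue. ((\<lambda>y. conv (poisson (Sg y) y) f x) \<longlongrightarrow> f x) (at_right 0)"
  using assms
proof (induction rule: integrable_induct)
  case (base A c)
  show ?case
  proof (rule conv_tendsto_of_approx)
    have "integrable lebesgue (indicator A :: 'a \<Rightarrow> real)" using base by (simp add: integrable_indicator_iff)
    then show "in_Lsum (\<lambda>x. indicator A x *\<^sub>R c)" by (intro in_Lsum_integrable) auto
    fix e :: real assume e: "e > 0"
    \<comment> \<open>Scaling by c multiplies the L^1 error by |c|; the added 1 covers c =
      0.\<close>
    define e' where "e' = e / (\<bar>c\<bar> + 1)"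
    have e': "e' > 0" using e by (simp add: e'_def add_nonneg_pos)
    obtain \<phi> :: "'a \<Rightarrow> real" where \<phi>: "continuous_on UNIV \<phi>" "\<And>x. 0 \<le> \<phi> x" "\<And>x. \<phi> x \<le> 1"
      "integrable lebesgue (\<lambda>x. indicator A x - \<phi> x)" "(\<integral>x. \<bar>indicator A x - \<phi> x\<bar> \<partial>lebesgue) \<le> e'"
      using indicator_L1_approx_continuous[OF base(1) e'] by blast
    define g where "g = (\<lambda>x. \<phi> x * c)"
    have gm: "g \<in> borel_measurable lebesgue"
      unfolding g_def using \<phi>(1) by (intro measurable_completion) (auto intro!: borel_measurable_continuous_onI continuous_intros)
    have gb: "\<bar>g z\<bar> \<le> \<bar>c\<bar>" for z
      using \<phi>(2,3)[of z] by (auto simp: g_def abs_mult intro!: mult_left_le_one_le)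
    have eq: "indicator A z *\<^sub>R c - g z = (indicator A z - \<phi> z) * c" for z by (simp add: g_def algebra_simps)
    show "\<exists>g. in_Lsum g \<and> integrable lebesgue (\<lambda>z. indicator A z *\<^sub>R c - g z) \<and>
      (\<integral>z. \<bar>indicator A z *\<^sub>R c - g z\<bar> \<partial>lebesgue) \<le> e \<and>
      (AE x in lebesgue. ((\<lambda>y. conv (poisson (Sg y) y) g x) \<longlongrightarrow> g x) (at_right 0))"
    proof (intro exI[of _ g] conjI)
      show "in_Lsum g" using gm gb by (intro in_Lsum_bounded[where K = "\<bar>c\<bar>"]) auto
      show "integrable lebesgue (\<lambda>z. indicator A z *\<^sub>R c - g z)"
        unfolding eq using \<phi>(4) by simp
      have "(\<integral>z. \<bar>indicator A z *\<^sub>R c - g z\<bar> \<partial>lebesgue) = (\<integral>z. \<bar>indicator A z - \<phi> z\<bar> \<partial>lebesgue) * \<bar>c\<bar>"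
        unfolding eq abs_mult by simp
      also have "\<dots> \<le> e' * (\<bar>c\<bar> + 1)"
        using \<phi>(5) e' by (intro mult_mono) auto
      also have "\<dots> = e" by (simp add: e'_def)
      finally show "(\<integral>z. \<bar>indicator A z *\<^sub>R c - g z\<bar> \<partial>lebesgue) \<le> e" .
      have "isCont g x" for x
        using \<phi>(1) unfolding g_def by (auto intro!: continuous_intros simp: continuous_on_eq_continuous_at)
      then show "AE x in lebesgue. ((\<lambda>y. conv (poisson (Sg y) y) g x) \<longlongrightarrow> g x) (at_right 0)"
        using conv_tendsto_at_continuity_point[OF gm gb] by auto
    qed
  qed
next
  case (add f g)
  from add(3,4) show ?case
  proof eventually_elim
    case (elim x)
    have "((\<lambda>y. conv (poisson (Sg y) y) f x + conv (poisson (Sg y) y) g x) \<longlongrightarrow> f x + g x) (at_right 0)"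
      using elim by (rule tendsto_add)
    then show ?case
    proof (rule Lim_transform_eventually)
      show "\<forall>\<^sub>F y in at_right 0. conv (poisson (Sg y) y) f x + conv (poisson (Sg y) y) g x
          = conv (poisson (Sg y) y) (\<lambda>x. f x + g x) x"
        using eventually_at_right_less[of 0]
      proof eventually_elim
        case (elim y)
        then show ?case
          unfolding conv_def distrib_left using add(1,2)
          by (intro Bochner_Integration.integral_add[symmetric] integrable_poisson_mult Sg in_Lsum_integrable)
      qed
    qed
  qed
next
  case (lim f s)
  show ?case
  proof (rule conv_tendsto_of_approx)
    show "in_Lsum f" using lim by (intro in_Lsum_integrable)
    fix e :: real assume e: "e > 0"
    have "(\<lambda>i. \<integral>x. \<bar>f x - s i x\<bar> \<partial>lebesgue) \<longlonglongrightarrow> (\<integral>x. 0 \<partial>(lebesgue :: 'a measure))"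
    \<comment> \<open>The induction rule supplies |s i x| <= 2 |f x|, hence the majorant 3 |f x| for
      the difference.\<close>
    proof (rule integral_dominated_convergence[where w = "\<lambda>x. 3 * \<bar>f x\<bar>"])
      show "integrable lebesgue (\<lambda>x. 3 * \<bar>f x\<bar>)" using lim by simp
      show "(\<lambda>x. \<bar>f x - s i x\<bar>) \<in> borel_measurable lebesgue" for i
        using lim(1)[of i] lim(4) by (auto dest!: borel_measurable_integrable)
      show "AE x in lebesgue. (\<lambda>i. \<bar>f x - s i x\<bar>) \<longlonglongrightarrow> 0"
      proof (rule AE_I2)
        fix x :: 'a
        have "(\<lambda>i. \<bar>f x - s i x\<bar>) \<longlonglongrightarrow> \<bar>f x - f x\<bar>"
          using lim(2)[of x] by (intro tendsto_intros) auto
        then show "(\<lambda>i. \<bar>f x - s i x\<bar>) \<longlonglongrightarrow> 0" by simp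
      qed
      show "AE x in lebesgue. norm \<bar>f x - s i x\<bar> \<le> 3 * \<bar>f x\<bar>" for i
      proof (rule AE_I2)
        fix x :: 'a
        show "norm \<bar>f x - s i x\<bar> \<le> 3 * \<bar>f x\<bar>" using lim(3)[of x i] by simp
      qed
    qed simp
    then have "\<forall>\<^sub>F i in sequentially. (\<integral>x. \<bar>f x - s i x\<bar> \<partial>lebesgue) < e"
      using e by (intro order_tendstoD) auto
    then obtain i where i: "(\<integral>x. \<bar>f x - s i x\<bar> \<partial>lebesgue) < e"
      by (auto simp: eventually_sequentially)
    show "\<exists>g. in_Lsum g \<and> integrable lebesgue (\<lambda>z. f z - g z) \<and>
      (\<integral>z. \<bar>f z - g z\<bar> \<partial>lebesgue) \<le> e \<and>
      (AE x in lebesgue. ((\<lambda>y. conv (poisson (Sg y) y) g x) \<longlongrightarrow> g x) (at_right 0))"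
      using i lim(1,4,5) by (intro exI[of _ "s i"]) (auto intro: in_Lsum_integrable)
  qed
qed

text \<open>On a ball of radius k the majorant K + g is integrable, so the cut-off of f falls under
  the integrable case. For |x| < k the remainder vanishes near x and its convolution tends to 0
  there.\<close>

lemma conv_tendsto_AE:
  fixes f :: "'a::euclidean_space \<Rightarrow> real"
  assumes f: "in_Lsum f"
  shows "AE x in lebesgue. ((\<lambda>y. conv (poisson (Sg y) y) f x) \<longlongrightarrow> f x) (at_right 0)"
proof -
  have fm[measurable]: "f \<in> borel_measurable lebesgue" using f by (rule in_Lsum_measurable)
  obtain K g where g: "integrable lebesgue g" "AE z in lebesgue. \<bar>f z\<bar> \<le> K + g z"
    using f by (auto simp: in_Lsum_def)
  define B where "B = (\<lambda>k::nat. ball (0::'a) (real k))"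
  have B[measurable]: "B k \<in> sets lebesgue" for k by (simp add: B_def)
  have near: "integrable lebesgue (\<lambda>z. f z * indicator (B k) z)" for k
  proof (rule Bochner_Integration.integrable_bound)
    have "integrable lebesgue (indicator (B k) :: 'a \<Rightarrow> real)"
      using B[of k] by (simp add: B_def integrable_indicator_iff emeasure_ball)
    then show "integrable lebesgue (\<lambda>z. \<bar>K\<bar> * indicator (B k) z + \<bar>g z\<bar>)"
      using g(1) by (intro Bochner_Integration.integrable_add integrable_mult_right integrable_abs)
    show "AE z in lebesgue. norm (f z * indicator (B k) z) \<le> norm (\<bar>K\<bar> * indicator (B k) z + \<bar>g z\<bar>)"
      using g(2) by eventually_elim (auto simp: indicator_def)
  qed measurable
  \<comment> \<open>One null set serves all k at once, so k may afterwards be chosen depending on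
    x.\<close>
  have "AE x in lebesgue. \<forall>k. ((\<lambda>y. conv (poisson (Sg y) y) (\<lambda>z. f z * indicator (B k) z) x)
      \<longlongrightarrow> f x * indicator (B k) x) (at_right 0)"
    unfolding AE_all_countable by (intro allI conv_tendsto_integrable near)
  then show ?thesis
  proof eventually_elim
    case (elim x)
    obtain k :: nat where k: "norm x < real k" using reals_Archimedean2 by blast
    let ?f1 = "\<lambda>z. f z * indicator (B k) z" and ?f2 = "\<lambda>z. f z * indicator (- B k) z"
    have cB: "- B k \<in> sets lebesgue" using B[of k] by (simp add: Compl_in_sets_lebesgue)
    have in12: "in_Lsum ?f1" "in_Lsum ?f2" using f B cB by (auto intro: in_Lsum_mult_indicator)
    have "((\<lambda>y. conv (poisson (Sg y) y) ?f2 x) \<longlongrightarrow> 0) (at_right 0)"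
    proof (rule conv_far_tendsto_0[OF in12(2)])
      show "0 < real k - norm x" using k by simp
      fix z assume "dist x z < real k - norm x"
      then have "z \<in> B k" using dist_triangle[of 0 z x] by (simp add: B_def)
      then show "f z * indicator (- B k) z = 0" by simp
    qed
    with elim have "((\<lambda>y. conv (poisson (Sg y) y) ?f1 x + conv (poisson (Sg y) y) ?f2 x)
        \<longlongrightarrow> f x * indicator (B k) x + 0) (at_right 0)"
      by (intro tendsto_add) auto
    moreover have "f x * indicator (B k) x + 0 = f x" using k by (simp add: B_def)
    ultimately have lim: "((\<lambda>y. conv (poisson (Sg y) y) ?f1 x + conv (poisson (Sg y) y) ?f2 x) \<longlongrightarrow> f x) (at_right 0)"
      by (simp only:)
    show ?case
    proof (rule Lim_transform_eventually[OF lim])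
      show "\<forall>\<^sub>F y in at_right 0. conv (poisson (Sg y) y) ?f1 x + conv (poisson (Sg y) y) ?f2 x
          = conv (poisson (Sg y) y) f x"
        using eventually_at_right_less[of 0]
      proof eventually_elim
        case (elim y)
        have "conv (poisson (Sg y) y) ?f1 x + conv (poisson (Sg y) y) ?f2 x
            = (\<integral>z. poisson (Sg y) y (x - z) * ?f1 z + poisson (Sg y) y (x - z) * ?f2 z \<partial>lebesgue)"
          unfolding conv_def using elim in12
          by (intro Bochner_Integration.integral_add[symmetric] integrable_poisson_mult Sg)
        also have "\<dots> = conv (poisson (Sg y) y) f x"
          unfolding conv_def by (intro Bochner_Integration.integral_cong) (auto simp: indicator_def)
        finally show ?case .
      qed
    qed
  qed
qed

end


theorem theorem2p1:
  fixes dummy :: "'a::euclidean_space"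
  shows
    "(\<exists>C>0. \<forall>f::'a \<Rightarrow> real. f \<in> borel_measurable lebesgue \<longrightarrow>
        (\<forall>x. Pstar f x \<le> ennreal C * maximal f x))
   \<and>    (\<exists>C>0. \<forall>f::'a \<Rightarrow> real. integrable lebesgue f \<longrightarrow>
        Pstar f \<in> borel_measurable lebesgue \<and>
        (\<forall>lam>0. emeasure lebesgue {x. Pstar f x > ennreal lam}
                  \<le> ennreal (C / lam * (\<integral> x. \<bar>f x\<bar> \<partial>lebesgue))))
   \<and>    (\<forall>p::real. 1 < p \<longrightarrow> (\<exists>C>0. \<forall>f::'a \<Rightarrow> real. in_Lp p f \<longrightarrow>
        Pstar f \<in> borel_measurable lebesgue \<and>
        (AE x in lebesgue. Pstar f x < top) \<and>
        in_Lp p (\<lambda>x. enn2real (Pstar f x)) \<and>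
        Lp_norm p (\<lambda>x. enn2real (Pstar f x)) \<le> C * Lp_norm p f))
   \<and>    (\<exists>C>0. \<forall>(f::'a \<Rightarrow> real) K. f \<in> borel_measurable lebesgue \<and> (AE x in lebesgue. \<bar>f x\<bar> \<le> K) \<longrightarrow>
        Pstar f \<in> borel_measurable lebesgue \<and>
        (AE x in lebesgue. Pstar f x \<le> ennreal (C * K)))
   \<and> (\<forall>Sg::real \<Rightarrow> real. (\<forall>y>0. 0 < Sg y \<and> Sg y < 2) \<and>
          filterlim (\<lambda>y. Sg y * ln y) at_bot (at_right 0) \<longrightarrow>
                (\<forall>lam>0. ((\<lambda>y. set_lebesgue_integral lebesgue {x::'a. norm x > lam} (poisson (Sg y) y))
                   \<longlongrightarrow> 0) (at_right 0))
              \<and> (\<forall>f::'a \<Rightarrow> real. ((\<exists>p\<ge>1. in_Lp p f) \<or> in_Linf f) \<longrightarrow>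
           (AE x in lebesgue. ((\<lambda>y. conv (poisson (Sg y) y) f x) \<longlongrightarrow> f x) (at_right 0))))"
proof (intro conjI)
  show "\<exists>C>0. \<forall>f::'a \<Rightarrow> real. f \<in> borel_measurable lebesgue \<longrightarrow>
        (\<forall>x. Pstar f x \<le> ennreal C * maximal f x)"
    by (intro exI[of _ 1]) (simp add: Pstar_le_maximal)
next
  show "\<exists>C>0. \<forall>f::'a \<Rightarrow> real. integrable lebesgue f \<longrightarrow>
        Pstar f \<in> borel_measurable lebesgue \<and>
        (\<forall>lam>0. emeasure lebesgue {x. Pstar f x > ennreal lam}
                  \<le> ennreal (C / lam * (\<integral> x. \<bar>f x\<bar> \<partial>lebesgue)))"
  proof (intro exI[of _ "5 ^ DIM('a)"] conjI allI impI)
    fix f :: "'a \<Rightarrow> real" and lam :: real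
    assume f: "integrable lebesgue f"
    show "Pstar f \<in> borel_measurable lebesgue" by (intro Pstar_measurable in_Lsum_integrable f)
    assume lam: "lam > 0"
    have "emeasure lebesgue {x. ennreal lam < Pstar f x}
        \<le> ennreal (5 ^ DIM('a) / lam) * (\<integral>\<^sup>+z. ennreal \<bar>f z\<bar> \<partial>lebesgue)"
      using lam borel_measurable_integrable[OF f] by (intro Pstar_weak_type)
    also have "(\<integral>\<^sup>+z. ennreal \<bar>f z\<bar> \<partial>lebesgue) = ennreal (\<integral>z. \<bar>f z\<bar> \<partial>lebesgue)"
      using f by (intro nn_integral_eq_integral) auto
    also have "ennreal (5 ^ DIM('a) / lam) * \<dots> = ennreal (5 ^ DIM('a) / lam * (\<integral>z. \<bar>f z\<bar> \<partial>lebesgue))"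
      using lam by (intro ennreal_mult[symmetric]) auto
    finally show "emeasure lebesgue {x. Pstar f x > ennreal lam}
        \<le> ennreal (5 ^ DIM('a) / lam * (\<integral> x. \<bar>f x\<bar> \<partial>lebesgue))" .
  qed simp
next
  show "\<forall>p::real. 1 < p \<longrightarrow> (\<exists>C>0. \<forall>f::'a \<Rightarrow> real. in_Lp p f \<longrightarrow>
        Pstar f \<in> borel_measurable lebesgue \<and>
        (AE x in lebesgue. Pstar f x < top) \<and>
        in_Lp p (\<lambda>x. enn2real (Pstar f x)) \<and>
        Lp_norm p (\<lambda>x. enn2real (Pstar f x)) \<le> C * Lp_norm p f)"
  proof (intro allI impI)
    fix p :: real assume p: "1 < p"
    have "Pstar f \<in> borel_measurable lebesgue" if "in_Lp p f" for f :: "'a \<Rightarrow> real"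
      using that p by (intro Pstar_measurable in_Lsum_Lp[of p]) auto
    moreover have "0 < (4 powr p * 5 ^ DIM('a) / (p - 1)) powr (1 / p)"
      using p by simp
    ultimately show "\<exists>C>0. \<forall>f::'a \<Rightarrow> real. in_Lp p f \<longrightarrow>
        Pstar f \<in> borel_measurable lebesgue \<and>
        (AE x in lebesgue. Pstar f x < top) \<and>
        in_Lp p (\<lambda>x. enn2real (Pstar f x)) \<and>
        Lp_norm p (\<lambda>x. enn2real (Pstar f x)) \<le> C * Lp_norm p f"
      using Pstar_strong_type[OF p] by blast
  qed
next
  show "\<exists>C>0. \<forall>(f::'a \<Rightarrow> real) K. f \<in> borel_measurable lebesgue \<and> (AE x in lebesgue. \<bar>f x\<bar> \<le> K) \<longrightarrow>
        Pstar f \<in> borel_measurable lebesgue \<and>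
        (AE x in lebesgue. Pstar f x \<le> ennreal (C * K))"
  proof (intro exI[of _ 1] conjI allI impI AE_I2)
    fix f :: "'a \<Rightarrow> real" and K
    assume f: "f \<in> borel_measurable lebesgue \<and> (AE x in lebesgue. \<bar>f x\<bar> \<le> K)"
    then show "Pstar f \<in> borel_measurable lebesgue"
      by (intro Pstar_measurable in_Lsum_bounded[of f K]) auto
    fix x
    show "Pstar f x \<le> ennreal (1 * K)" using Pstar_le_Linf[of f K x] f by simp
  qed simp
next
  show "\<forall>Sg::real \<Rightarrow> real. (\<forall>y>0. 0 < Sg y \<and> Sg y < 2) \<and>
          filterlim (\<lambda>y. Sg y * ln y) at_bot (at_right 0) \<longrightarrow>
                (\<forall>lam>0. ((\<lambda>y. set_lebesgue_integral lebesgue {x::'a. norm x > lam} (poisson (Sg y) y))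
                   \<longlongrightarrow> 0) (at_right 0))
              \<and> (\<forall>f::'a \<Rightarrow> real. ((\<exists>p\<ge>1. in_Lp p f) \<or> in_Linf f) \<longrightarrow>
           (AE x in lebesgue. ((\<lambda>y. conv (poisson (Sg y) y) f x) \<longlongrightarrow> f x) (at_right 0)))"
  proof (intro allI impI)
    fix Sg :: "real \<Rightarrow> real"
    assume Sg: "(\<forall>y>0. 0 < Sg y \<and> Sg y < 2) \<and> filterlim (\<lambda>y. Sg y * ln y) at_bot (at_right 0)"
    then interpret concentrating Sg by unfold_locales auto
    show "(\<forall>lam>0. ((\<lambda>y. set_lebesgue_integral lebesgue {x::'a. norm x > lam} (poisson (Sg y) y))
                   \<longlongrightarrow> 0) (at_right 0))
              \<and> (\<forall>f::'a \<Rightarrow> real. ((\<exists>p\<ge>1. in_Lp p f) \<or> in_Linf f) \<longrightarrow>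
           (AE x in lebesgue. ((\<lambda>y. conv (poisson (Sg y) y) f x) \<longlongrightarrow> f x) (at_right 0)))"
    proof (intro conjI allI impI)
      fix lam :: real assume lam: "lam > 0"
      \<comment> \<open>The tail estimate is applied at the centre 0, where the kernel appears
        reflected; it is even.\<close>
      have "poisson (Sg y) y (0 - z) = poisson (Sg y) y z" for y and z :: 'a
        by (simp add: poisson_def)
      moreover have "{x::'a. norm x > lam} \<in> sets lebesgue"
        by (simp add: open_Collect_less continuous_intros)
      ultimately show "((\<lambda>y. set_lebesgue_integral lebesgue {x::'a. norm x > lam} (poisson (Sg y) y)) \<longlongrightarrow> 0) (at_right 0)"
        using tail_tendsto_0[OF lam, of "{x::'a. norm x > lam}" 0]
        by (simp add: set_lebesgue_integral_def mult.commute subset_iff)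
    next
      fix f :: "'a \<Rightarrow> real" assume "(\<exists>p\<ge>1. in_Lp p f) \<or> in_Linf f"
      then have "in_Lsum f" by (auto simp: in_Linf_def intro: in_Lsum_Lp in_Lsum_bounded)
      then show "AE x in lebesgue. ((\<lambda>y. conv (poisson (Sg y) y) f x) \<longlongrightarrow> f x) (at_right 0)"
        by (rule conv_tendsto_AE)
    qed
  qed
qed

end
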